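(* Let $\{x_k\}_{k\ge1}$ be the sequence of iterates of the SZO-QQ algorithm (described in the context) when its termination conditions are removed. Suppose that $\{x_k\}_{k\ge1}$ has an accumulation point $x_c$ such that: (a) LICQ holds at $x_c$, i.e. the gradients $\nabla f_i(x_c)$, $i\in\{i\in\{1,\dots,m\}:f_i(x_c)=0\}$, are linearly independent; (b) the unique $\lambda_c\in\mathbb{R}^m_{\ge0}$ for which $(x_c,\lambda_c)$ is a KKT pair of $\min_{x\in\Omega}f_0(x)$ satisfies $\|\lambda_c\|_\infty<\Lambda$, where $\Lambda>0$ is the input of the algorithm; (c) $x_c$ is a strict local minimizer, i.e. there is a neighborhood $\mathcal{N}$ of $x_c$ with $f_0(x)>f_0(x_c)$ for all $x\in(\mathcal{N}\cap\Omega)\setminus\{x_c\}$. For $\eta>0$ let $$h(\eta)=\min\Big\{\frac{\eta}{60\Lambda\sum_{i=1}^mM_i},\ \frac{\eta}{12\mu},\ 1,\ \frac{\eta}{4\Lambda(\alpha_{\max}+2L_{\max}+2M_{\max})}\Big\}.$$ Then there exists $0<\bar\eta<1$ such that, for any $0<\eta<\bar\eta$, the SZO-QQ algorithm with $\xi=h(\eta)$ terminates within $\overline{\mathcal{K}}(\eta)+1$ iterations, where $$\overline{\mathcal{K}}(\eta)=\frac{f_0(x_0)-\inf\{f_0(x):x\in\Omega\}}{\mu\,(h(\eta))^2}$$ and $\mu$ is the coefficient of the quadratic penalty term in the subproblem. Thus, given $C_1>0$, if the initial point is selected such that $f_0(x_0)-\inf\{f_0(x):x\in\Omega\}<C_1$,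 then for any $0<\eta\le\bar\eta$ the algorithm takes at most $O(d/\eta^2)$ iterations and $O(d^2/\eta^2)$ samples to return $(\tilde x,\tilde\lambda)$, an $\eta$-KKT pair of $\min_{x\in\Omega}f_0(x)$.
   Context: Problem. Let $d,m\ge1$, let $f_0,\dots,f_m:\mathbb{R}^d\to\mathbb{R}$ be continuously differentiable with $f_0$ linear, and $\Omega=\{x\in\mathbb{R}^d: f_i(x)\le0,\ i=1,\dots,m\}$. The problem is $\min_{x\in\Omega}f_0(x)$. $\|\cdot\|$ is the Euclidean norm, $e_j$ the standard basis vectors of $\mathbb{R}^d$. Standing assumptions. (1) There are known constants $L_i,M_i>0$ ($i=0,\dots,m$) and a set $\overline\Omega\supset\Omega$ such that for all $x_1,x_2\in\overline\Omega$: $|f_i(x_1)-f_i(x_2)|\le L_i\|x_1-x_2\|$ and $\|\nabla f_i(x_1)-\nabla f_i(x_2)\|\le M_i\|x_1-x_2\|$; moreover $L_i>L_{i,\inf}$ and $M_i>M_{i,\inf}$, where $L_{i,\inf}$ and $M_{i,\inf}$ are the infima of the constants for which these respective inequalities hold for all $x_1,x_2\in\Omega$. (2) $x_0$ is a given strictly feasible point: $f_i(x_0)<0$ for $i=1,\dots,m$. (3) There is $\beta\in\mathbb{R}$ such that $\{x\in\Omega: f_0(x)\le\beta\}$ is bounded and contains $x_0$. SZO-QQ iterates. Parameters $\mu,\Lambda,\xi>0$ and accuracy $\eta>0$. Let $L_{\max}=\max_{1\le i\le m}L_i$, $M_{\max}=\max_{1\le i\le m}M_i$, $\alpha_i=\sqrt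 d\,M_i/2$, $\alpha_{\max}=\max_{1\le i\le m}\alpha_i$, and $\nabla^{\nu}f_i(x)=\sum_{j=1}^d\frac{f_i(x+\nu e_j)-f_i(x)}{\nu}e_j$. For $k\ge0$, given $x_k$, put $l_k^*=\min_{1\le i\le m}(-f_i(x_k))/L_{\max}$, $\nu_k^*=\min\{l_k^*/\sqrt d,\ 1/k,\ \eta/(12\alpha_{\max}m\Lambda)\}$ (the term $1/k$ being omitted for $k=0$), $$\mathcal{S}^{(k)}(x_k)=\bigcap_{i=1}^m\{x: f_i(x_k)+\nabla^{\nu_k^*}f_i(x_k)^\top(x-x_k)+2M_i\|x-x_k\|^2\le0\},$$ and let $x_{k+1}$ be the minimizer of the subproblem $\min\{f_0(x)+\mu\|x-x_k\|^2: x\in\mathcal{S}^{(k)}(x_k)\}$. Samples are evaluations of the functions; each iteration uses the $d+1$ sample points $x_k$ and $x_k+\nu_k^*e_j$, $j=1,\dots,d$. Termination conditions. For $\lambda\in\mathbb{R}^m_{\ge0}$ let $$\delta_1(k,\lambda)=\Big\|\nabla f_0(x_{k+1})+2\mu(x_{k+1}-x_k)+\sum_{i=1}^m\lambda^{(i)}\big(\nabla^{\nu_k^*}f_i(x_k)+4M_i(x_{k+1}-x_k)\big)\Big\|,$$ $$\delta_2^{(i)}(k,\lambda)=\Big|\lambda^{(i)}\big(f_i(x_k)+\nabla^{\nu_k^*}f_i(x_k)^\top(x_{k+1}-x_k)+2M_i\|x_{k+1}-x_k\|^2\big)\Big|.$$ After computing $x_{k+1}$, if $\|x_{k+1}-x_k\|\le\xi$,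 let $\lambda_{k+1}$ be a minimizer of $\|\lambda\|_\infty$ over $\lambda\in\mathbb{R}^m_{\ge0}$ subject to $\max\{\delta_1(k,\lambda),\max_{1\le i\le m}\delta_2^{(i)}(k,\lambda)\}\le\eta/2$; if moreover $\|\lambda_{k+1}\|_\infty\le2\Lambda$, the algorithm stops and outputs $\tilde x=x_{k+1}$, $\tilde\lambda=\lambda_{k+1}$, and iteration number $\tilde k=k+1$. Otherwise $k$ is increased by one and the loop continues. KKT notions. For $\eta\ge0$, $(x,\lambda)\in\Omega\times\mathbb{R}^m_{\ge0}$ is an $\eta$-KKT pair of $\min_{x\in\Omega}f_0(x)$ if $\|\nabla f_0(x)+\sum_{i=1}^m\lambda^{(i)}\nabla f_i(x)\|\le\eta$ and $|\lambda^{(i)}f_i(x)|\le\eta$ for $i=1,\dots,m$; a KKT pair is the case $\eta=0$. (Under LICQ at the accumulation point $x_c$, a unique $\lambda_c\in\mathbb{R}^m_{\ge0}$ making $(x_c,\lambda_c)$ a KKT pair exists.)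
   Formalization: Since the iterates depend on η via ν_k*, "accumulation point x_c" is taken uniformly: each neighborhood of x_c contains x_k for arbitrarily large k, the same k serving all sufficiently small η; with x_c an accumulation point for each η separately, the claim is false. *)

theory Defs
  imports "HOL-Analysis.Analysis"
begin

text \<open>Throughout, the type \<open>'n\<close> indexes the coordinates of \<open>real ^ 'n\<close> and the type \<open>'m\<close> indexes the
  constraints, so \<open>d = CARD('n) \<ge> 1\<close> and \<open>m = CARD('m) \<ge> 1\<close>. The objective \<open>f0\<close> is kept separate from
  the constraint functions \<open>f i\<close>.\<close>

definition grad :: "('a::real_inner \<Rightarrow> real) \<Rightarrow> 'a \<Rightarrow> 'a" where
  "grad g x = (THE D. GDERIV g x :> D)"

definition cont_diff :: "('a::real_inner \<Rightarrow> real) \<Rightarrow> bool" where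
  "cont_diff g \<longleftrightarrow> (\<forall>x. \<exists>D. GDERIV g x :> D) \<and> continuous_on UNIV (grad g)"

definition feasible_set :: "('m \<Rightarrow> 'a \<Rightarrow> real) \<Rightarrow> 'a set" where
  "feasible_set f = {x. \<forall>i. f i x \<le> 0}"

text \<open>\<open>Om\<close> is the feasible set and \<open>Ob\<close> the larger set on which the known constants are valid.\<close>

definition smoothness_constants ::
    "'a::real_inner set \<Rightarrow> 'a set \<Rightarrow> ('a \<Rightarrow> real) \<Rightarrow> real \<Rightarrow> real \<Rightarrow> bool" where
  "smoothness_constants Om Ob g Lg Mg \<longleftrightarrow>
     Lg > 0 \<and> Mg > 0 \<and> Lg-lipschitz_on Ob g \<and> Mg-lipschitz_on Ob (grad g) \<and>
     Lg > Inf {C. C-lipschitz_on Om g} \<and> Mg > Inf {C. C-lipschitz_on Om (grad g)}"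

definition kkt_pair ::
    "real \<Rightarrow> ('a::real_inner \<Rightarrow> real) \<Rightarrow> ('m::finite \<Rightarrow> 'a \<Rightarrow> real) \<Rightarrow> 'a \<Rightarrow> real ^ 'm \<Rightarrow> bool" where
  "kkt_pair \<eta> f0 f x l \<longleftrightarrow>
     x \<in> feasible_set f \<and> (\<forall>i. 0 \<le> l $ i) \<and>
     norm (grad f0 x + (\<Sum>i\<in>UNIV. (l $ i) *\<^sub>R grad (f i) x)) \<le> \<eta> \<and>
     (\<forall>i. \<bar>l $ i * f i x\<bar> \<le> \<eta>)"

text \<open>The gradients are required to be independent as a family, hence the injectivity.\<close>

definition licq :: "('m \<Rightarrow> 'a::real_inner \<Rightarrow> real) \<Rightarrow> 'a \<Rightarrow> bool" where
  "licq f x \<longleftrightarrow>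
     inj_on (\<lambda>i. grad (f i) x) {i. f i x = 0} \<and>
     independent ((\<lambda>i. grad (f i) x) ` {i. f i x = 0})"

definition strict_local_minimizer ::
    "('a::topological_space \<Rightarrow> real) \<Rightarrow> 'a set \<Rightarrow> 'a \<Rightarrow> bool" where
  "strict_local_minimizer g S x \<longleftrightarrow>
     (\<exists>N. open N \<and> x \<in> N \<and> (\<forall>y \<in> (N \<inter> S) - {x}. g y > g x))"

text \<open>The iterates depend on the accuracy \<open>\<eta>\<close> through the sampling radii, so "the sequence of iterates"
  is a family \<open>X \<eta>\<close>. A point \<open>c\<close> is an accumulation point of the family as \<open>\<eta>\<close> decreases to 0 if every
  neighbourhood of \<open>c\<close> contains terms of arbitrarily large index, the index not depending on \<open>\<eta>\<close> for small
  \<open>\<eta>\<close>. If \<open>X \<eta>\<close> does not depend on \<open>\<eta>\<close>, this is the usual notion for a single sequence.\<close>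

definition accumulation_point :: "(real \<Rightarrow> nat \<Rightarrow> 'a::topological_space) \<Rightarrow> 'a \<Rightarrow> bool" where
  "accumulation_point X c \<longleftrightarrow>
     (\<forall>N. open N \<and> c \<in> N \<longrightarrow> (\<forall>K. \<exists>k\<ge>K. \<forall>\<^sub>F \<eta> in at_right 0. X \<eta> k \<in> N))"

text \<open>In \<open>alpha_max\<close>, \<open>h_tol\<close> and \<open>iter_bound\<close> the dimension is a numerical argument \<open>d\<close>, so that estimates
  uniform in the dimension can be stated.\<close>

definition alpha_max :: "nat \<Rightarrow> ('m::finite \<Rightarrow> real) \<Rightarrow> real" where
  "alpha_max d M = Max (range (\<lambda>i. sqrt (real d) * M i / 2))"

definition fd_grad :: "real \<Rightarrow> (real ^ 'n::finite \<Rightarrow> real) \<Rightarrow> real ^ 'n \<Rightarrow> real ^ 'n" where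
  "fd_grad \<nu> g x = (\<Sum>j\<in>UNIV. ((g (x + \<nu> *\<^sub>R axis j 1) - g x) / \<nu>) *\<^sub>R axis j 1)"

definition safe_radius ::
    "('m::finite \<Rightarrow> 'a \<Rightarrow> real) \<Rightarrow> ('m \<Rightarrow> real) \<Rightarrow> 'a \<Rightarrow> real" where
  "safe_radius f L x = Min (range (\<lambda>i. - f i x)) / Max (range L)"

definition sampling_radius ::
    "('m::finite \<Rightarrow> real ^ 'n::finite \<Rightarrow> real) \<Rightarrow> ('m \<Rightarrow> real) \<Rightarrow> ('m \<Rightarrow> real) \<Rightarrow>
     real \<Rightarrow> real \<Rightarrow> nat \<Rightarrow> real ^ 'n \<Rightarrow> real" where
  "sampling_radius f L M \<Lambda> \<eta> k x =
     Min ({safe_radius f L x / sqrt (real CARD('n)),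
           \<eta> / (12 * alpha_max CARD('n) M * real CARD('m) * \<Lambda>)} \<union>
          (if k = 0 then {} else {1 / real k}))"

definition quad_model ::
    "real \<Rightarrow> (real ^ 'n::finite \<Rightarrow> real) \<Rightarrow> real \<Rightarrow> real ^ 'n \<Rightarrow> real ^ 'n \<Rightarrow> real" where
  "quad_model \<nu> g c x y = g x + fd_grad \<nu> g x \<bullet> (y - x) + 2 * c * (norm (y - x))\<^sup>2"

definition local_set ::
    "real \<Rightarrow> ('m::finite \<Rightarrow> real ^ 'n::finite \<Rightarrow> real) \<Rightarrow> ('m \<Rightarrow> real) \<Rightarrow> real ^ 'n \<Rightarrow> (real ^ 'n) set" where
  "local_set \<nu> f M x = (\<Inter>i. {y. quad_model \<nu> (f i) (M i) x y \<le> 0})"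

primrec szo_iterate ::
    "(real ^ 'n::finite \<Rightarrow> real) \<Rightarrow> ('m::finite \<Rightarrow> real ^ 'n \<Rightarrow> real) \<Rightarrow> ('m \<Rightarrow> real) \<Rightarrow> ('m \<Rightarrow> real) \<Rightarrow>
     real \<Rightarrow> real \<Rightarrow> real ^ 'n \<Rightarrow> real \<Rightarrow> nat \<Rightarrow> real ^ 'n" where
  "szo_iterate f0 f L M \<mu> \<Lambda> x0 \<eta> 0 = x0"
| "szo_iterate f0 f L M \<mu> \<Lambda> x0 \<eta> (Suc k) =
     (let x = szo_iterate f0 f L M \<mu> \<Lambda> x0 \<eta> k in
      arg_min_on (\<lambda>y. f0 y + \<mu> * (norm (y - x))\<^sup>2)
        (local_set (sampling_radius f L M \<Lambda> \<eta> k x) f M x))"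

text \<open>In \<open>delta1\<close>, \<open>delta2\<close> and \<open>multipliers\<close>, \<open>x\<close> and \<open>y\<close> are the current and the next iterate and \<open>\<nu>\<close>
  is the sampling radius at \<open>x\<close>.\<close>

definition delta1 ::
    "(real ^ 'n::finite \<Rightarrow> real) \<Rightarrow> ('m::finite \<Rightarrow> real ^ 'n \<Rightarrow> real) \<Rightarrow> ('m \<Rightarrow> real) \<Rightarrow> real \<Rightarrow>
     real \<Rightarrow> real ^ 'n \<Rightarrow> real ^ 'n \<Rightarrow> real ^ 'm \<Rightarrow> real" where
  "delta1 f0 f M \<mu> \<nu> x y l =
     norm (grad f0 y + (2 * \<mu>) *\<^sub>R (y - x) +
       (\<Sum>i\<in>UNIV. (l $ i) *\<^sub>R (fd_grad \<nu> (f i) x + (4 * M i) *\<^sub>R (y - x))))"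

definition delta2 ::
    "('m::finite \<Rightarrow> real ^ 'n::finite \<Rightarrow> real) \<Rightarrow> ('m \<Rightarrow> real) \<Rightarrow>
     real \<Rightarrow> real ^ 'n \<Rightarrow> real ^ 'n \<Rightarrow> real ^ 'm \<Rightarrow> 'm \<Rightarrow> real" where
  "delta2 f M \<nu> x y l i = \<bar>l $ i * quad_model \<nu> (f i) (M i) x y\<bar>"

definition multipliers ::
    "(real ^ 'n::finite \<Rightarrow> real) \<Rightarrow> ('m::finite \<Rightarrow> real ^ 'n \<Rightarrow> real) \<Rightarrow> ('m \<Rightarrow> real) \<Rightarrow> real \<Rightarrow> real \<Rightarrow>
     real \<Rightarrow> real ^ 'n \<Rightarrow> real ^ 'n \<Rightarrow> (real ^ 'm) set" where
  "multipliers f0 f M \<mu> \<eta> \<nu> x y =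
     {l. (\<forall>i. 0 \<le> l $ i) \<and>
         max (delta1 f0 f M \<mu> \<nu> x y l) (Max (range (delta2 f M \<nu> x y l))) \<le> \<eta> / 2}"

text \<open>\<open>szo_accepts \<dots> k l\<close>: after the computation of iterate \<open>k + 1\<close> the stopping test succeeds, with \<open>l\<close> as
  the selected multiplier of least maximum norm.\<close>

definition szo_accepts ::
    "(real ^ 'n::finite \<Rightarrow> real) \<Rightarrow> ('m::finite \<Rightarrow> real ^ 'n \<Rightarrow> real) \<Rightarrow> ('m \<Rightarrow> real) \<Rightarrow> ('m \<Rightarrow> real) \<Rightarrow>
     real \<Rightarrow> real \<Rightarrow> real ^ 'n \<Rightarrow> real \<Rightarrow> real \<Rightarrow> nat \<Rightarrow> real ^ 'm \<Rightarrow> bool" where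
  "szo_accepts f0 f L M \<mu> \<Lambda> x0 \<eta> \<xi> k l \<longleftrightarrow>
     (let x = szo_iterate f0 f L M \<mu> \<Lambda> x0 \<eta> k;
          y = szo_iterate f0 f L M \<mu> \<Lambda> x0 \<eta> (Suc k);
          \<nu> = sampling_radius f L M \<Lambda> \<eta> k x
      in norm (y - x) \<le> \<xi> \<and>
         is_arg_min infnorm (\<lambda>l'. l' \<in> multipliers f0 f M \<mu> \<eta> \<nu> x y) l \<and>
         infnorm l \<le> 2 * \<Lambda>)"

text \<open>\<open>szo_returns \<dots> xt lt kt\<close>: the algorithm terminates with output \<open>(xt, lt)\<close> and iteration number \<open>kt\<close>.\<close>

definition szo_returns ::
    "(real ^ 'n::finite \<Rightarrow> real) \<Rightarrow> ('m::finite \<Rightarrow> real ^ 'n \<Rightarrow> real) \<Rightarrow> ('m \<Rightarrow> real) \<Rightarrow> ('m \<Rightarrow> real) \<Rightarrow>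
     real \<Rightarrow> real \<Rightarrow> real ^ 'n \<Rightarrow> real \<Rightarrow> real \<Rightarrow> real ^ 'n \<Rightarrow> real ^ 'm \<Rightarrow> nat \<Rightarrow> bool" where
  "szo_returns f0 f L M \<mu> \<Lambda> x0 \<eta> \<xi> xt lt kt \<longleftrightarrow>
     (\<exists>k. kt = k + 1 \<and> szo_accepts f0 f L M \<mu> \<Lambda> x0 \<eta> \<xi> k lt \<and>
          (\<forall>j<k. \<nexists>l. szo_accepts f0 f L M \<mu> \<Lambda> x0 \<eta> \<xi> j l) \<and>
          xt = szo_iterate f0 f L M \<mu> \<Lambda> x0 \<eta> kt)"

definition sample_points ::
    "(real ^ 'n::finite \<Rightarrow> real) \<Rightarrow> ('m::finite \<Rightarrow> real ^ 'n \<Rightarrow> real) \<Rightarrow> ('m \<Rightarrow> real) \<Rightarrow> ('m \<Rightarrow> real) \<Rightarrow>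
     real \<Rightarrow> real \<Rightarrow> real ^ 'n \<Rightarrow> real \<Rightarrow> nat \<Rightarrow> (real ^ 'n) set" where
  "sample_points f0 f L M \<mu> \<Lambda> x0 \<eta> k =
     (let x = szo_iterate f0 f L M \<mu> \<Lambda> x0 \<eta> k
      in insert x (range (\<lambda>j. x + sampling_radius f L M \<Lambda> \<eta> k x *\<^sub>R axis j 1)))"

definition num_samples ::
    "(real ^ 'n::finite \<Rightarrow> real) \<Rightarrow> ('m::finite \<Rightarrow> real ^ 'n \<Rightarrow> real) \<Rightarrow> ('m \<Rightarrow> real) \<Rightarrow> ('m \<Rightarrow> real) \<Rightarrow>
     real \<Rightarrow> real \<Rightarrow> real ^ 'n \<Rightarrow> real \<Rightarrow> nat \<Rightarrow> nat" where
  "num_samples f0 f L M \<mu> \<Lambda> x0 \<eta> kt = (\<Sum>k<kt. card (sample_points f0 f L M \<mu> \<Lambda> x0 \<eta> k))"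

definition h_tol ::
    "nat \<Rightarrow> ('m::finite \<Rightarrow> real) \<Rightarrow> ('m \<Rightarrow> real) \<Rightarrow> real \<Rightarrow> real \<Rightarrow> real \<Rightarrow> real" where
  "h_tol d L M \<mu> \<Lambda> \<eta> =
     Min {\<eta> / (60 * \<Lambda> * (\<Sum>i\<in>UNIV. M i)), \<eta> / (12 * \<mu>), 1,
          \<eta> / (4 * \<Lambda> * (alpha_max d M + 2 * Max (range L) + 2 * Max (range M)))}"

text \<open>The argument \<open>G\<close> is the initial optimality gap, or an upper bound of it.\<close>

definition iter_bound ::
    "nat \<Rightarrow> ('m::finite \<Rightarrow> real) \<Rightarrow> ('m \<Rightarrow> real) \<Rightarrow> real \<Rightarrow> real \<Rightarrow> real \<Rightarrow> real \<Rightarrow> real" where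
  "iter_bound d L M \<mu> \<Lambda> G \<eta> = G / (\<mu> * (h_tol d L M \<mu> \<Lambda> \<eta>)\<^sup>2)"

text \<open>\<open>C\<close> is an admissible constant for \<open>O(d / \<eta>\<^sup>2)\<close> iterations and \<open>O(d\<^sup>2 / \<eta>\<^sup>2)\<close> samples (there are
  \<open>d + 1\<close> of them per iteration), simultaneously for all dimensions \<open>d\<close> and all accuracies up to 1. The
  condition involves neither an initial point nor functions: \<open>C\<close> depends on \<open>L\<close>, \<open>M\<close>, \<open>\<mu>\<close>, \<open>\<Lambda>\<close>, \<open>C1\<close> only.\<close>

definition complexity_const ::
    "('m::finite \<Rightarrow> real) \<Rightarrow> ('m \<Rightarrow> real) \<Rightarrow> real \<Rightarrow> real \<Rightarrow> real \<Rightarrow> real \<Rightarrow> bool" where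
  "complexity_const L M \<mu> \<Lambda> C1 C \<longleftrightarrow>
     (\<forall>d \<eta>. 1 \<le> d \<longrightarrow> 0 < \<eta> \<longrightarrow> \<eta> \<le> 1 \<longrightarrow>
        iter_bound d L M \<mu> \<Lambda> C1 \<eta> + 1 \<le> C * real d / \<eta>\<^sup>2 \<and>
        (real d + 1) * (iter_bound d L M \<mu> \<Lambda> C1 \<eta> + 1) \<le> C * (real d)\<^sup>2 / \<eta>\<^sup>2)"

end

theory Submission
  imports Defs
begin

text \<open>Each step decreases \<open>f0\<close> by at least \<open>\<mu>\<close> times its squared length, so among the first
  \<open>gap / (\<mu> * h\<^sup>2) + 1\<close> steps one has length at most \<open>h\<close>. It remains to see that such a step passes the
  multiplier test. For small \<open>\<eta>\<close> it cannot be an early step: the margin of strict feasibility after \<open>k\<close>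
  steps, and with it the length of the next step, is bounded below independently of \<open>\<eta>\<close>. The late
  iterates, on the other hand, stay near \<open>xc\<close>: the segment between consecutive iterates is feasible and
  \<open>f0\<close> is linear, so a long step would pass through feasible points near \<open>xc\<close> with values below
  \<open>f0 xc\<close>. Near \<open>xc\<close> the exact multipliers of the subproblem, which exist by Slater's condition, are by
  LICQ within \<open>\<Lambda>\<close> of those at \<open>xc\<close>, hence at most \<open>2 * \<Lambda>\<close>.\<close>

section \<open>Smooth functions and finite differences\<close>

text \<open>The obstacle is that the iterates vary with \<open>\<eta>\<close>, through the sampling
  radii, so no argument along one fixed sequence is available. Estimates of single steps therefore
  hold for every admissible radius, and the constants drawn from them are fixed before
  \<open>\<eta>\<close>. The Lipschitz constants are applied on the feasible set, which need not be
  convex, so feasibility of a segment has to be earned by following it up to a first possible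
  violation. One visit near \<open>xc\<close> is enough: strict minimality and descent make a
  neighbourhood of \<open>xc\<close> forward invariant, and the accumulation hypothesis supplies a
  visit whose index does not depend on \<open>\<eta>\<close>. Early steps must be excluded for two
  reasons: multipliers are controlled only near \<open>xc\<close>, and at index 0 the radius is not
  capped by \<open>1 / k\<close>, a cap used in the complementarity estimate. The constants of
  \<open>h\<close> come from an error budget. The stopping test leaves \<open>\<eta> / 2\<close>;
  for stationarity it is split into three parts \<open>\<eta> / 6\<close>, for the penalty, the
  curvature and the finite differences.\<close>

lemma cont_diff_GDERIV: "cont_diff g \<Longrightarrow> GDERIV g x :> grad g x"
  unfolding cont_diff_def grad_def
proof (rule theI')
  assume "(\<forall>x. \<exists>D. GDERIV g x :> D) \<and> continuous_on UNIV (\<lambda>x. THE D. GDERIV g x :> D)"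
  then obtain D where D: "GDERIV g x :> D" by blast
  moreover have "E = D" if "GDERIV g x :> E" for E
  proof -
    have "(\<lambda>h. h \<bullet> E) = (\<lambda>h. h \<bullet> D)"
      using that D unfolding gderiv_def by (rule has_derivative_unique)
    then show ?thesis unfolding fun_eq_iff by (simp only: vector_eq_ldot)
  qed
  ultimately show "\<exists>!D. GDERIV g x :> D" by blast
qed

lemma cont_diff_continuous: "cont_diff g \<Longrightarrow> continuous_on S g"
  using cont_diff_GDERIV[of g] unfolding gderiv_def
  by (blast intro: continuous_at_imp_continuous_on has_derivative_continuous)

lemma GDERIV_line:
  assumes "GDERIV g (x + t *\<^sub>R v) :> D"
  shows "((\<lambda>s. g (x + s *\<^sub>R v)) has_real_derivative D \<bullet> v) (at t)"
proof -
  have "((\<lambda>s. x + s *\<^sub>R v) has_derivative (\<lambda>s. s *\<^sub>R v)) (at t)"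
    by (auto intro!: derivative_eq_intros)
  from has_derivative_compose[OF this] assms
  have "((\<lambda>s. g (x + s *\<^sub>R v)) has_derivative (\<lambda>s. (s *\<^sub>R v) \<bullet> D)) (at t)"
    unfolding gderiv_def by blast
  then show ?thesis
    by (rule has_derivative_imp_has_field_derivative) (simp add: inner_commute mult.commute)
qed

lemma grad_linear:
  fixes g :: "'a::euclidean_space \<Rightarrow> real"
  assumes "linear g" "cont_diff g"
  shows "g y = y \<bullet> grad g x"
proof -
  have "(g has_derivative g) (at x)"
    using assms(1) by (simp add: linear_imp_has_derivative)
  moreover have "(g has_derivative (\<lambda>h. h \<bullet> grad g x)) (at x)"
    using cont_diff_GDERIV[OF assms(2)] unfolding gderiv_def .
  ultimately have "g = (\<lambda>h. h \<bullet> grad g x)" by (rule has_derivative_unique)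
  then show ?thesis by (rule fun_cong)
qed

lemma in_closed_segment_ray: "0 \<le> t \<Longrightarrow> t \<le> 1 \<Longrightarrow> x + t *\<^sub>R (y - x) \<in> closed_segment x y"
  unfolding closed_segment_def by (auto simp: algebra_simps intro!: exI[of _ t])

lemma closed_segment_ray: "closed_segment x y = (\<lambda>t. x + t *\<^sub>R (y - x)) ` {0..1}"
proof -
  have "x + t *\<^sub>R (y - x) = (1 - t) *\<^sub>R x + t *\<^sub>R y" for t
    by (simp add: algebra_simps)
  then show ?thesis unfolding closed_segment_def by auto
qed

text \<open>The hypothesis concerns one segment only, because \<open>S\<close> will be the feasible
  set, which need not be convex. Along the segment the linearization error has derivative at most
  \<open>C * t\<close> times the squared length, whence the factor 1/2.\<close>

lemma taylor_lipschitz_grad: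
  fixes g :: "'a::real_inner \<Rightarrow> real"
  assumes g: "cont_diff g" and seg: "closed_segment x y \<subseteq> S" and lip: "C-lipschitz_on S (grad g)"
  shows "\<bar>g y - g x - grad g x \<bullet> (y - x)\<bar> \<le> C / 2 * (norm (y - x))\<^sup>2"
proof -
  define v where "v = y - x"
  have dev: "\<bar>(grad g (x + t *\<^sub>R v) - grad g x) \<bullet> v\<bar> \<le> C * t * (norm v)\<^sup>2" if t: "0 \<le> t" "t \<le> 1" for t :: real
  proof -
    have "norm (grad g (x + t *\<^sub>R v) - grad g x) \<le> C * norm (t *\<^sub>R v)"
      using lipschitz_onD[OF lip, of "x + t *\<^sub>R v" x] in_closed_segment_ray[OF t, of x y] seg
        ends_in_segment(1)[of x y] unfolding v_def by (auto simp: dist_norm)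
    then have "norm (grad g (x + t *\<^sub>R v) - grad g x) * norm v \<le> C * t * norm v * norm v"
      using t by (intro mult_right_mono) auto
    then show ?thesis
      using Cauchy_Schwarz_ineq2[of "grad g (x + t *\<^sub>R v) - grad g x" v] by (simp add: power2_eq_square)
  qed
  have D: "((\<lambda>t. g (x + t *\<^sub>R v) - t * (grad g x \<bullet> v)) has_real_derivative
      (grad g (x + t *\<^sub>R v) - grad g x) \<bullet> v) (at t)" for t
    using GDERIV_line[where x = x and t = t and v = v, OF cont_diff_GDERIV[OF g]]
    by (auto intro!: derivative_eq_intros simp: inner_diff_left)
  \<comment> \<open>In place of an integral, the two one-sided bounds come from monotonicity in
    \<open>t\<close> of the error with a parabola subtracted, respectively added.\<close>
  have "g (x + 1 *\<^sub>R v) - 1 * (grad g x \<bullet> v) - C / 2 * 1\<^sup>2 * (norm v)\<^sup>2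
      \<le> g (x + 0 *\<^sub>R v) - 0 * (grad g x \<bullet> v) - C / 2 * 0\<^sup>2 * (norm v)\<^sup>2"
  proof (rule DERIV_nonpos_imp_nonincreasing[where a = 0 and b = 1 and f = "\<lambda>t. g (x + t *\<^sub>R v) - t * (grad g x \<bullet> v) - C / 2 * t\<^sup>2 * (norm v)\<^sup>2"])
    show "\<exists>e. ((\<lambda>t. g (x + t *\<^sub>R v) - t * (grad g x \<bullet> v) - C / 2 * t\<^sup>2 * (norm v)\<^sup>2)
        has_real_derivative e) (at t) \<and> e \<le> 0" if "0 \<le> t" "t \<le> 1" for t :: real
      by (rule exI[of _ "(grad g (x + t *\<^sub>R v) - grad g x) \<bullet> v - C * t * (norm v)\<^sup>2"])
        (use dev[OF that] in \<open>auto intro!: DERIV_diff[OF D] derivative_eq_intros\<close>)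
  qed simp
  moreover have "g (x + 0 *\<^sub>R v) - 0 * (grad g x \<bullet> v) + C / 2 * 0\<^sup>2 * (norm v)\<^sup>2
      \<le> g (x + 1 *\<^sub>R v) - 1 * (grad g x \<bullet> v) + C / 2 * 1\<^sup>2 * (norm v)\<^sup>2"
  proof (rule DERIV_nonneg_imp_nondecreasing[where a = 0 and b = 1 and f = "\<lambda>t. g (x + t *\<^sub>R v) - t * (grad g x \<bullet> v) + C / 2 * t\<^sup>2 * (norm v)\<^sup>2"])
    show "\<exists>e. ((\<lambda>t. g (x + t *\<^sub>R v) - t * (grad g x \<bullet> v) + C / 2 * t\<^sup>2 * (norm v)\<^sup>2)
        has_real_derivative e) (at t) \<and> 0 \<le> e" if "0 \<le> t" "t \<le> 1" for t :: real
      by (rule exI[of _ "(grad g (x + t *\<^sub>R v) - grad g x) \<bullet> v + C * t * (norm v)\<^sup>2"])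
        (use dev[OF that] in \<open>auto intro!: DERIV_add[OF D] derivative_eq_intros\<close>)
  qed simp
  ultimately show ?thesis unfolding v_def abs_le_iff by simp
qed

text \<open>A Lipschitz constant on \<open>S\<close> does not bound the norm of the gradient, since
  \<open>S\<close> may be thin at \<open>x\<close>. Only difference quotients along the segment are
  controlled, which suffices for the derivative in its direction.\<close>

lemma directional_derivative_bound:
  assumes g: "cont_diff g" and seg: "closed_segment x y \<subseteq> S" and lip: "C-lipschitz_on S g"
  shows "\<bar>grad g x \<bullet> (y - x)\<bar> \<le> C * norm (y - x)"
proof (rule tendsto_upperbound)
  have "((\<lambda>t. g (x + t *\<^sub>R (y - x))) has_real_derivative grad g x \<bullet> (y - x)) (at 0)"
    using GDERIV_line[of g x 0] cont_diff_GDERIV[OF g] by auto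
  then have "((\<lambda>t. (g (x + t *\<^sub>R (y - x)) - g x) / t) \<longlongrightarrow> grad g x \<bullet> (y - x)) (at 0)"
    unfolding DERIV_def by simp
  then have "((\<lambda>t. (g (x + t *\<^sub>R (y - x)) - g x) / t) \<longlongrightarrow> grad g x \<bullet> (y - x)) (at_right 0)"
    by (rule filterlim_mono) (auto simp: at_le)
  then show "((\<lambda>t. \<bar>(g (x + t *\<^sub>R (y - x)) - g x) / t\<bar>) \<longlongrightarrow> \<bar>grad g x \<bullet> (y - x)\<bar>) (at_right 0)"
    by (rule tendsto_rabs)
  have "\<forall>\<^sub>F t::real in at_right 0. t \<in> {0<..<1}"
    by (rule eventually_at_right_real) simp
  then show "\<forall>\<^sub>F t in at_right 0. \<bar>(g (x + t *\<^sub>R (y - x)) - g x) / t\<bar> \<le> C * norm (y - x)"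
  proof eventually_elim
    case (elim t)
    then have "x + t *\<^sub>R (y - x) \<in> S" "x \<in> S"
      using in_closed_segment_ray[of t x y] ends_in_segment(1)[of x y] seg by auto
    from lipschitz_onD[OF lip this] elim show ?case
      by (auto simp: dist_norm divide_simps mult_ac)
  qed
qed simp

lemma norm_le_sqrt_CARD:
  fixes x :: "real ^ 'n::finite"
  assumes "\<And>j. \<bar>x $ j\<bar> \<le> b"
  shows "norm x \<le> sqrt (real CARD('n)) * b"
proof -
  have "infnorm x \<le> b" unfolding infnorm_cart using assms by (intro cSup_least) auto
  then have "sqrt (real CARD('n)) * infnorm x \<le> sqrt (real CARD('n)) * b"
    by (intro mult_left_mono) auto
  moreover have "norm x \<le> sqrt (real CARD('n)) * infnorm x"
    using norm_le_infnorm[of x] by simp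
  ultimately show ?thesis by linarith
qed

lemma fd_grad_nth: "fd_grad \<nu> g x $ j = (g (x + \<nu> *\<^sub>R axis j 1) - g x) / \<nu>"
proof -
  have "fd_grad \<nu> g x $ j = (\<Sum>i\<in>UNIV. if i = j then (g (x + \<nu> *\<^sub>R axis i 1) - g x) / \<nu> else 0)"
    unfolding fd_grad_def sum_component by (rule sum.cong) (auto simp: axis_def)
  then show ?thesis by simp
qed

lemma fd_grad_error:
  fixes g :: "real ^ 'n::finite \<Rightarrow> real"
  assumes g: "cont_diff g" and lip: "C-lipschitz_on S (grad g)" and \<nu>: "0 < \<nu>"
    and seg: "\<And>j. closed_segment x (x + \<nu> *\<^sub>R axis j 1) \<subseteq> S"
  shows "norm (fd_grad \<nu> g x - grad g x) \<le> sqrt (real CARD('n)) * C / 2 * \<nu>"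
proof -
  have "\<bar>(fd_grad \<nu> g x - grad g x) $ j\<bar> \<le> C / 2 * \<nu>" for j
  proof -
    have "\<bar>g (x + \<nu> *\<^sub>R axis j 1) - g x - \<nu> * grad g x $ j\<bar> \<le> C / 2 * \<nu>\<^sup>2"
      using taylor_lipschitz_grad[OF g seg lip, of j] \<nu> by (simp add: inner_axis)
    then have "\<bar>(g (x + \<nu> *\<^sub>R axis j 1) - g x - \<nu> * grad g x $ j) / \<nu>\<bar> \<le> C / 2 * \<nu>"
      using \<nu> by (simp add: divide_simps power2_eq_square)
    then show ?thesis using \<nu> by (simp add: fd_grad_nth diff_divide_distrib)
  qed
  from norm_le_sqrt_CARD[OF this] show ?thesis by simp
qed

text \<open>Breaks a circularity: bounds that show a point of the segment to be feasible hold only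
  if the segment up to that point is feasible. At the first parameter where some constraint reaches
  0 everything before is feasible, so \<open>step\<close> applies and contradicts the
  choice.\<close>

lemma segment_continuation:
  fixes f :: "'m::finite \<Rightarrow> 'a::real_normed_vector \<Rightarrow> real"
  assumes cont: "\<And>i. continuous_on UNIV (f i)" and x: "\<And>i. f i x < 0"
    and step: "\<And>t i. 0 < t \<Longrightarrow> t < 1 \<Longrightarrow> closed_segment x (x + t *\<^sub>R (y - x)) \<subseteq> feasible_set f
      \<Longrightarrow> f i (x + t *\<^sub>R (y - x)) < 0"
  shows "closed_segment x y \<subseteq> feasible_set f"
proof (rule ccontr)
  assume "\<not> ?thesis"
  then obtain z where "z \<in> closed_segment x y" "z \<notin> feasible_set f" by blast
  then obtain s i where s: "0 \<le> s" "s \<le> 1" and i: "f i (x + s *\<^sub>R (y - x)) > 0"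
    unfolding closed_segment_ray feasible_set_def by (auto simp: not_le)
  define Z where "Z = (\<Union>i. {t \<in> {0..1}. f i (x + t *\<^sub>R (y - x)) \<ge> 0})"
  have line: "continuous_on UNIV (\<lambda>r. f i (x + r *\<^sub>R (y - x)))" for i
    by (intro continuous_on_compose2[OF cont[of i]] continuous_intros) auto
  have cl: "closed {t \<in> {0..1::real}. f i (x + t *\<^sub>R (y - x)) \<ge> 0}" for i
  proof -
    have "closed ({0..1} \<inter> {t. 0 \<le> f i (x + t *\<^sub>R (y - x))})"
      by (intro closed_Int closed_Collect_le line continuous_intros closed_atLeastAtMost)
    then show ?thesis by (simp add: Int_def)
  qed
  have Z: "compact Z"
    unfolding compact_eq_bounded_closed
  proof
    have "Z \<subseteq> {0..1}" unfolding Z_def by auto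
    then show "bounded Z" by (rule bounded_subset[rotated]) simp
    show "closed Z" unfolding Z_def using cl by (intro closed_UN) auto
  qed
  have sZ: "s \<in> Z" using s less_imp_le[OF i] unfolding Z_def by auto
  then have "Z \<noteq> {}" by auto
  from compact_attains_inf[OF Z this] obtain t where t: "t \<in> Z" "\<And>r. r \<in> Z \<Longrightarrow> t \<le> r"
    by auto
  from t(1) obtain j where j: "0 \<le> t" "t \<le> 1" "f j (x + t *\<^sub>R (y - x)) \<ge> 0"
    unfolding Z_def by auto
  have before: "f i (x + r *\<^sub>R (y - x)) < 0" if r: "0 \<le> r" "r < t" for r i
  proof -
    have "r \<notin> Z" using t(2)[of r] r by auto
    then show ?thesis using r j(2) unfolding Z_def by (auto simp: not_le)
  qed
  have "t \<noteq> 0" using j(3) x[of j] by auto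
  with j have t0: "0 < t" by simp
  have at: "f i (x + t *\<^sub>R (y - x)) \<le> 0" for i
  proof (rule tendsto_upperbound)
    from line[of i] have "((\<lambda>r. f i (x + r *\<^sub>R (y - x))) \<longlongrightarrow> f i (x + t *\<^sub>R (y - x))) (at t)"
      by (simp add: continuous_on_def)
    then show "((\<lambda>r. f i (x + r *\<^sub>R (y - x))) \<longlongrightarrow> f i (x + t *\<^sub>R (y - x))) (at_left t)"
      by (rule filterlim_mono) (auto simp: at_le)
    have "\<forall>\<^sub>F r in at_left t. r \<in> {0<..<t}" using t0 by (rule eventually_at_left_real)
    then show "\<forall>\<^sub>F r in at_left t. f i (x + r *\<^sub>R (y - x)) \<le> 0"
      by eventually_elim (use before in \<open>auto intro: less_imp_le\<close>)
  qed simp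
  have "f i (x + r *\<^sub>R (y - x)) \<le> 0" if "0 \<le> r" "r \<le> t" for r i
    using before[of r i] at[of i] that by (cases "r = t") auto
  then have seg: "closed_segment x (x + t *\<^sub>R (y - x)) \<subseteq> feasible_set f"
    unfolding closed_segment_ray[of x "x + _"] feasible_set_def
    using t0 by (auto simp: mult_left_le_one_le)
  \<comment> \<open>\<open>step\<close> covers only \<open>t < 1\<close>. At the endpoint the limit
    \<open>at\<close> decides: the violated parameter \<open>s\<close> would have to be 1, where all
    constraints are already known to be at most 0.\<close>
  have "t = 1" using step[OF t0 _ seg, of j] j by (cases "t = 1") auto
  with t(2)[OF sZ] s have "s = t" by simp
  with i at[of i] show False by simp
qed

section \<open>Multipliers\<close>

text \<open>If 0 lies outside the convex hull of the objective gradient and the active constraint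
  gradients, the negative normal of a separating hyperplane decreases all these functions to first
  order. Inactive constraints stay negative by continuity, so minimality fails.\<close>

lemma fritz_john:
  fixes F :: "'a::euclidean_space \<Rightarrow> real" and q :: "'m::finite \<Rightarrow> 'a \<Rightarrow> real"
  assumes F: "GDERIV F x :> g" and q: "\<And>i. GDERIV (q i) x :> G i"
    and feas: "\<And>i. q i x \<le> 0"
    and min: "\<forall>\<^sub>F y in nhds x. (\<forall>i. q i y \<le> 0) \<longrightarrow> F x \<le> F y"
  obtains u w where "0 \<le> u" "\<And>i. 0 \<le> w i" "\<And>i. w i * q i x = 0" "0 < u \<or> (\<exists>i. 0 < w i)"
    "u *\<^sub>R g + (\<Sum>i\<in>UNIV. w i *\<^sub>R G i) = 0"
proof -
  define A where "A = {i. q i x = 0}"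
  define S where "S = insert g (G ` A)"
  have "finite S" unfolding S_def by simp
  have "0 \<in> convex hull S"
  proof (rule ccontr)
    assume 0: "0 \<notin> convex hull S"
    have cl: "closed (convex hull S)"
      using \<open>finite S\<close> by (simp add: compact_imp_closed finite_imp_compact_convex_hull)
    from separating_hyperplane_closed_0[OF convex_convex_hull cl 0]
    obtain a b where ab: "0 < b" "\<And>v. v \<in> convex hull S \<Longrightarrow> a \<bullet> v > b"
      by auto
    have neg: "v \<bullet> (- a) < 0" if "v \<in> S" for v
      using ab(2)[of v] ab(1) hull_inc[OF that, of convex] by (simp add: inner_commute)
    have dec: "\<forall>\<^sub>F t in at_right 0. p (x + t *\<^sub>R (- a)) < p x"
      if p: "GDERIV p x :> v" and v: "v \<in> S" for p v
    proof -
      have "((\<lambda>t. p (x + t *\<^sub>R (- a))) has_real_derivative v \<bullet> (- a)) (at 0)"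
        using GDERIV_line[of p x 0 "- a" v] p by simp
      from DERIV_neg_dec_right[OF this neg[OF v]] obtain d where "d > 0"
        "\<And>t. 0 < t \<Longrightarrow> t < d \<Longrightarrow> p (x + t *\<^sub>R (- a)) < p x"
        by auto
      then show ?thesis unfolding eventually_at_right_field by auto
    qed
    have line: "((\<lambda>t. x + t *\<^sub>R (- a)) \<longlongrightarrow> x) (at_right 0)"
      by (auto intro!: tendsto_eq_intros)
    have "\<forall>\<^sub>F t in at_right 0. q i (x + t *\<^sub>R (- a)) \<le> 0" for i
    proof (cases "i \<in> A")
      case True
      then show ?thesis using dec[OF q[of i]] feas[of i] unfolding S_def
        by (auto elim!: eventually_mono)
    next
      case False
      have "isCont (q i) x" using q[of i] unfolding gderiv_def by (rule has_derivative_continuous)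
      then have "((\<lambda>t. q i (x + t *\<^sub>R (- a))) \<longlongrightarrow> q i x) (at_right 0)"
        using line by (rule isCont_tendsto_compose)
      moreover have "q i x < 0" using False feas[of i] unfolding A_def by simp
      ultimately have "\<forall>\<^sub>F t in at_right 0. q i (x + t *\<^sub>R (- a)) < 0" by (rule order_tendstoD(2))
      then show ?thesis by (rule eventually_mono) simp
    qed
    then have "\<forall>\<^sub>F t in at_right 0. \<forall>i. q i (x + t *\<^sub>R (- a)) \<le> 0"
      by (rule eventually_all_finite)
    moreover have "\<forall>\<^sub>F t in at_right 0. F (x + t *\<^sub>R (- a)) < F x"
      using dec[OF F] unfolding S_def by simp
    moreover have "\<forall>\<^sub>F t in at_right 0. (\<forall>i. q i (x + t *\<^sub>R (- a)) \<le> 0) \<longrightarrow> F x \<le> F (x + t *\<^sub>R (- a))"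
      using line min unfolding filterlim_iff by blast
    ultimately have "\<forall>\<^sub>F t in at_right (0::real). False" by eventually_elim auto
    then show False by simp
  qed
  then obtain c where c: "\<And>v. v \<in> S \<Longrightarrow> 0 \<le> c v" "sum c S = 1" "(\<Sum>v\<in>S. c v *\<^sub>R v) = 0"
    unfolding convex_hull_finite[OF \<open>finite S\<close>] by auto
  \<comment> \<open>The convex combination is indexed by vectors, the multipliers by constraints.
    Each vector gets one representative index in \<open>P\<close>; a constraint gradient equal to
    \<open>g\<close> is credited to the objective.\<close>
  define V where "V = G ` A - {g}"
  define P where "P = inv_into A G ` V"
  define w where "w i = (if i \<in> P then c (G i) else 0)" for i
  have inv: "G (inv_into A G v) = v" if "v \<in> V" for v
    using that unfolding V_def by (auto intro: f_inv_into_f)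
  have PA: "P \<subseteq> A" unfolding P_def V_def by (auto intro: inv_into_into)
  have GP: "G i \<in> V" if "i \<in> P" for i using that inv unfolding P_def by auto
  have SV: "S = insert g V" "g \<notin> V" "finite V" "V \<subseteq> S" unfolding S_def V_def by auto
  have "(\<Sum>i\<in>UNIV. w i *\<^sub>R G i) = (\<Sum>i\<in>P. c (G i) *\<^sub>R G i)"
    unfolding w_def by (auto intro: sum.mono_neutral_cong_right)
  also have "\<dots> = (\<Sum>v\<in>V. c v *\<^sub>R v)"
    unfolding P_def using inj_on_inv_into[of V G A] inv
    by (subst sum.reindex) (auto simp: V_def)
  finally have "c g *\<^sub>R g + (\<Sum>i\<in>UNIV. w i *\<^sub>R G i) = 0"
    using c(3) SV by simp
  moreover have "0 < c g \<or> (\<exists>i. 0 < w i)"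
  proof (rule ccontr)
    assume nonpos: "\<not> ?thesis"
    have "c v = 0" if "v \<in> V" for v
    proof -
      have "w (inv_into A G v) = c v" using inv[OF that] that unfolding w_def P_def by auto
      with nonpos have "\<not> 0 < c v" by metis
      with c(1)[of v] SV(4) that show ?thesis by (auto simp: not_less intro: order_antisym)
    qed
    then have "sum c S = c g" using SV by simp
    with c(2) nonpos show False by simp
  qed
  moreover have "0 \<le> w i" for i using c(1)[of "G i"] GP SV(4) unfolding w_def by auto
  moreover have "w i * q i x = 0" for i using PA unfolding w_def A_def by auto
  moreover have "0 \<le> c g" using c(1) unfolding S_def by simp
  ultimately show ?thesis using that by blast
qed

text \<open>\<open>cq\<close> excludes nontrivial nonnegative combinations of active gradients equal
  to 0, so the objective multiplier is positive and can be scaled to 1. It is abstract because LICQ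
  supplies it at \<open>xc\<close> and Slater's condition in the subproblem.\<close>

lemma kkt_multipliers:
  fixes F :: "'a::euclidean_space \<Rightarrow> real" and q :: "'m::finite \<Rightarrow> 'a \<Rightarrow> real"
  assumes F: "GDERIV F x :> g" and q: "\<And>i. GDERIV (q i) x :> G i"
    and feas: "\<And>i. q i x \<le> 0"
    and min: "\<forall>\<^sub>F y in nhds x. (\<forall>i. q i y \<le> 0) \<longrightarrow> F x \<le> F y"
    and cq: "\<And>w. (\<And>i. 0 \<le> w i) \<Longrightarrow> (\<And>i. w i * q i x = 0) \<Longrightarrow> (\<Sum>i\<in>UNIV. w i *\<^sub>R G i) = 0
      \<Longrightarrow> (\<And>i. w i = 0)"
  obtains l :: "real ^ 'm" where "\<And>i. 0 \<le> l $ i" "\<And>i. l $ i * q i x = 0"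
    "g + (\<Sum>i\<in>UNIV. (l $ i) *\<^sub>R G i) = 0"
proof -
  obtain u w where uw: "0 \<le> u" "\<And>i. 0 \<le> w i" "\<And>i. w i * q i x = 0" "0 < u \<or> (\<exists>i. 0 < w i)"
    "u *\<^sub>R g + (\<Sum>i\<in>UNIV. w i *\<^sub>R G i) = 0"
    by (rule fritz_john[OF F q feas min], rule that)
  have "u \<noteq> 0"
  proof
    assume "u = 0"
    with cq[OF uw(2,3)] uw(4,5) show False by auto
  qed
  with uw(1) have u: "0 < u" by simp
  define l :: "real ^ 'm" where "l = (\<chi> i. w i / u)"
  have "g + (\<Sum>i\<in>UNIV. (l $ i) *\<^sub>R G i) = (1 / u) *\<^sub>R (u *\<^sub>R g + (\<Sum>i\<in>UNIV. w i *\<^sub>R G i))"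
    using u unfolding l_def by (simp add: scaleR_right_distrib scaleR_sum_right)
  then have "g + (\<Sum>i\<in>UNIV. (l $ i) *\<^sub>R G i) = 0" by (simp add: uw(5))
  moreover have "l $ i * q i x = 0" "0 \<le> l $ i" for i using uw(2,3)[of i] u unfolding l_def by auto
  ultimately show ?thesis using that by blast
qed

text \<open>Vectors supported on the active set form a subspace on which LICQ makes the linear map
  injective, hence bounded below in finite dimension. Existence, uniqueness and stability of
  multipliers all rest on this quantitative form.\<close>

lemma licq_lower_bound:
  fixes f :: "'m::finite \<Rightarrow> 'a::euclidean_space \<Rightarrow> real"
  assumes "licq f x"
  obtains e where "0 < e" "\<And>l::real ^ 'm. (\<And>i. l $ i * f i x = 0) \<Longrightarrow>
    e * norm l \<le> norm (\<Sum>i\<in>UNIV. (l $ i) *\<^sub>R grad (f i) x)"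
proof -
  define A where "A = {i. f i x = 0}"
  define T where "T l = (\<Sum>i\<in>UNIV. (l $ i) *\<^sub>R grad (f i) x)" for l :: "real ^ 'm"
  define U where "U = {l :: real ^ 'm. \<forall>i. l $ i * f i x = 0}"
  have "subspace U" unfolding U_def subspace_def
    by (simp add: distrib_right) (metis add_0)
  then have U: "closed U" "subspace U" by (simp_all add: closed_subspace)
  have "linear T" unfolding T_def
    by (intro linearI) (simp_all add: scaleR_left_distrib sum.distrib scaleR_sum_right)
  then have "bounded_linear T" by (simp add: linear_conv_bounded_linear)
  moreover have "l = 0" if l: "l \<in> U" "T l = 0" for l
  proof -
    let ?h = "\<lambda>i. grad (f i) x"
    have inj: "inj_on ?h A" and ind: "independent (?h ` A)"
      using assms unfolding licq_def A_def by auto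
    have inv: "inv_into A ?h (?h i) = i" if "i \<in> A" for i
      using inv_into_f_f[OF inj that] .
    have "T l = (\<Sum>i\<in>A. (l $ i) *\<^sub>R ?h i)"
      using l(1) unfolding T_def U_def A_def by (intro sum.mono_neutral_right) auto
    also have "\<dots> = (\<Sum>v\<in>?h ` A. (l $ inv_into A ?h v) *\<^sub>R v)"
      unfolding sum.reindex[OF inj] using inv by (auto intro!: sum.cong)
    finally have "(\<Sum>v\<in>?h ` A. (l $ inv_into A ?h v) *\<^sub>R v) = 0" using l(2) by simp
    with ind have z: "l $ inv_into A ?h v = 0" if "v \<in> ?h ` A" for v
      using that real_vector.independentD[of "?h ` A" "?h ` A" "\<lambda>v. l $ inv_into A ?h v"] by simp
    have "l $ i = 0" for i
    proof (cases "i \<in> A")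
      case True
      then show ?thesis using z[of "?h i"] inv by simp
    next
      case False
      then show ?thesis using l(1) unfolding U_def A_def by auto
    qed
    then show ?thesis by (simp add: vec_eq_iff)
  qed
  ultimately obtain e where "e > 0" "\<forall>l\<in>U. norm (T l) \<ge> e * norm l"
    using injective_imp_isometric[OF U, of T] by blast
  then show ?thesis using that unfolding U_def T_def by blast
qed

text \<open>The two stationarity equations are subtracted. The error involves the unknown
  \<open>norm l\<close>, which is split into \<open>norm (l - lc) + norm lc\<close> so that the
  first part can be absorbed on the left.\<close>

lemma licq_multiplier_bound:
  fixes f :: "'m::finite \<Rightarrow> 'a::euclidean_space \<Rightarrow> real" and lc :: "real ^ 'm"
  assumes licq: "licq f x" and \<Lambda>: "0 < \<Lambda>"
    and lc: "\<And>i. lc $ i * f i x = 0" "g + (\<Sum>i\<in>UNIV. (lc $ i) *\<^sub>R grad (f i) x) = 0"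
  obtains r where "0 < r" "\<And>b a l. norm (b - g) \<le> r \<Longrightarrow> (\<And>i. norm (a i - grad (f i) x) \<le> r) \<Longrightarrow>
    (\<And>i. l $ i * f i x = 0) \<Longrightarrow> b + (\<Sum>i\<in>UNIV. (l $ i) *\<^sub>R a i) = 0 \<Longrightarrow> norm (l - lc) \<le> \<Lambda>"
proof -
  obtain e where e: "0 < e" "\<And>l::real ^ 'm. (\<And>i. l $ i * f i x = 0) \<Longrightarrow>
    e * norm l \<le> norm (\<Sum>i\<in>UNIV. (l $ i) *\<^sub>R grad (f i) x)"
    by (rule licq_lower_bound[OF licq]) blast
  define m where "m = real CARD('m)"
  have m: "m > 0" unfolding m_def by simp
  have pos: "1 + m * norm lc > 0" using m by (auto intro: add_pos_nonneg)
  \<comment> \<open>The first bound lets half of \<open>e * norm (l - lc)\<close> absorb the term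
    \<open>m * r * norm (l - lc)\<close>; the second keeps the remaining error below
    \<open>e * \<Lambda> / 2\<close>.\<close>
  define r where "r = min (e / (2 * m)) (e * \<Lambda> / (2 * (1 + m * norm lc)))"
  have r: "0 < r" "m * r \<le> e / 2" "r * (1 + m * norm lc) \<le> e * \<Lambda> / 2"
  proof -
    show "0 < r" unfolding r_def using e m \<Lambda> pos by simp
    have "r \<le> e / (2 * m)" unfolding r_def by simp
    then show "m * r \<le> e / 2" using m by (simp add: field_simps)
    have "r \<le> e * \<Lambda> / (2 * (1 + m * norm lc))" unfolding r_def by simp
    then show "r * (1 + m * norm lc) \<le> e * \<Lambda> / 2" using pos by (simp add: field_simps)
  qed
  show ?thesis
  proof (rule that[OF r(1)])
    fix b a and l :: "real ^ 'm"
    assume b: "norm (b - g) \<le> r" and a: "\<And>i. norm (a i - grad (f i) x) \<le> r"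
      and l: "\<And>i. l $ i * f i x = 0" "b + (\<Sum>i\<in>UNIV. (l $ i) *\<^sub>R a i) = 0"
    have "e * norm (l - lc) \<le> norm (\<Sum>i\<in>UNIV. ((l - lc) $ i) *\<^sub>R grad (f i) x)"
      using l(1) lc(1) by (intro e(2)) (simp only: vector_minus_component left_diff_distrib)
    also have "(\<Sum>i\<in>UNIV. ((l - lc) $ i) *\<^sub>R grad (f i) x)
        = - (b - g) - (\<Sum>i\<in>UNIV. (l $ i) *\<^sub>R (a i - grad (f i) x))"
      using l(2) lc(2) by (simp add: scaleR_diff_left scaleR_diff_right sum_subtractf algebra_simps
        eq_neg_iff_add_eq_0[symmetric])
    also have "norm \<dots> \<le> norm (- (b - g)) + (\<Sum>i\<in>UNIV. norm ((l $ i) *\<^sub>R (a i - grad (f i) x)))"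
      by (intro order_trans[OF norm_triangle_ineq4] add_mono norm_sum order_refl)
    also have "\<dots> \<le> r + (\<Sum>i\<in>(UNIV :: 'm set). norm l * r)"
      using b a component_le_norm_cart[of l] unfolding norm_minus_cancel norm_scaleR
      by (intro add_mono sum_mono mult_mono) auto
    also have "\<dots> = r + m * r * norm l" unfolding m_def by simp
    also have "\<dots> \<le> r + m * r * (norm (l - lc) + norm lc)"
      using m r(1) norm_triangle_ineq[of "l - lc" lc] by (intro add_left_mono mult_left_mono) auto
    also have "\<dots> = r * (1 + m * norm lc) + m * r * norm (l - lc)" by (simp add: algebra_simps)
    also have "\<dots> \<le> e * \<Lambda> / 2 + e / 2 * norm (l - lc)"
      using r by (intro add_mono mult_right_mono) auto
    finally have "e * norm (l - lc) \<le> e * \<Lambda>" by simp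
    then show "norm (l - lc) \<le> \<Lambda>" using e(1) by simp
  qed
qed

lemma kkt_pair_0_iff:
  "kkt_pair 0 f0 f x l \<longleftrightarrow> x \<in> feasible_set f \<and> (\<forall>i. 0 \<le> l $ i) \<and>
    grad f0 x + (\<Sum>i\<in>UNIV. (l $ i) *\<^sub>R grad (f i) x) = 0 \<and> (\<forall>i. l $ i * f i x = 0)"
  unfolding kkt_pair_def by simp

text \<open>Gives meaning to the definite description by which the hypothesis on the multiplier at
  \<open>xc\<close> is expressed.\<close>

lemma kkt_pair_unique:
  fixes f :: "'m::finite \<Rightarrow> 'a::euclidean_space \<Rightarrow> real"
  assumes licq: "licq f x" and k: "kkt_pair 0 f0 f x k" and l: "kkt_pair 0 f0 f x l"
  shows "k = l"
proof -
  obtain e where e: "0 < e" "\<And>l::real ^ 'm. (\<And>i. l $ i * f i x = 0) \<Longrightarrow>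
    e * norm l \<le> norm (\<Sum>i\<in>UNIV. (l $ i) *\<^sub>R grad (f i) x)"
    by (rule licq_lower_bound[OF licq]) blast
  have "(\<Sum>i\<in>UNIV. ((k - l) $ i) *\<^sub>R grad (f i) x)
      = (grad f0 x + (\<Sum>i\<in>UNIV. (k $ i) *\<^sub>R grad (f i) x))
        - (grad f0 x + (\<Sum>i\<in>UNIV. (l $ i) *\<^sub>R grad (f i) x))"
    by (simp add: scaleR_diff_left sum_subtractf)
  also have "\<dots> = 0" using k l unfolding kkt_pair_0_iff by simp
  finally have "(\<Sum>i\<in>UNIV. ((k - l) $ i) *\<^sub>R grad (f i) x) = 0" .
  moreover have "(k - l) $ i * f i x = 0" for i
    using k l unfolding kkt_pair_0_iff vector_minus_component left_diff_distrib by (metis diff_zero)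
  ultimately have "e * norm (k - l) \<le> 0" using e(2)[of "k - l"] by simp
  then show ?thesis using e(1) by (simp add: mult_le_0_iff)
qed

lemma kkt_pair_exists:
  fixes f :: "'m::finite \<Rightarrow> 'a::euclidean_space \<Rightarrow> real"
  assumes f0: "cont_diff f0" and f: "\<And>i. cont_diff (f i)" and x: "x \<in> feasible_set f"
    and licq: "licq f x" and min: "strict_local_minimizer f0 (feasible_set f) x"
  obtains l where "kkt_pair 0 f0 f x l"
proof (rule kkt_multipliers[where F = f0 and q = f and x = x])
  show "GDERIV f0 x :> grad f0 x" "GDERIV (f i) x :> grad (f i) x" for i
    using f0 f by (auto intro: cont_diff_GDERIV)
  show "f i x \<le> 0" for i using x unfolding feasible_set_def by simp
  obtain N where N: "open N" "x \<in> N" "\<And>z. z \<in> N \<Longrightarrow> z \<in> feasible_set f \<Longrightarrow> z \<noteq> x \<Longrightarrow> f0 x < f0 z"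
    using min unfolding strict_local_minimizer_def by blast
  have "\<forall>\<^sub>F z in nhds x. z \<in> N" using N(1,2) by (rule eventually_nhds_in_open)
  then show "\<forall>\<^sub>F z in nhds x. (\<forall>i. f i z \<le> 0) \<longrightarrow> f0 x \<le> f0 z"
    by eventually_elim (use N(3) in \<open>force simp: feasible_set_def intro: less_imp_le\<close>)
next
  fix w :: "'m \<Rightarrow> real" and j
  assume w: "\<And>i. w i * f i x = 0" "(\<Sum>i\<in>UNIV. w i *\<^sub>R grad (f i) x) = 0"
  obtain e where e: "0 < e" "\<And>l::real ^ 'm. (\<And>i. l $ i * f i x = 0) \<Longrightarrow>
    e * norm l \<le> norm (\<Sum>i\<in>UNIV. (l $ i) *\<^sub>R grad (f i) x)"
    by (rule licq_lower_bound[OF licq]) blast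
  have "e * norm (\<chi> i. w i) \<le> 0" using e(2)[of "\<chi> i. w i"] w by simp
  then have "(\<chi> i. w i) = (0 :: real ^ 'm)" using e(1) by (simp add: mult_le_0_iff)
  then show "w j = 0" by (metis vec_lambda_beta zero_index)
next
  fix l :: "real ^ 'm"
  assume "\<And>i. 0 \<le> l $ i" "\<And>i. l $ i * f i x = 0" "grad f0 x + (\<Sum>i\<in>UNIV. (l $ i) *\<^sub>R grad (f i) x) = 0"
  then have "kkt_pair 0 f0 f x l" using x unfolding kkt_pair_0_iff by blast
  then show thesis by (rule that)
qed

section \<open>Quadratic models and the subproblem\<close>

lemma quad_model_GDERIV:
  "GDERIV (quad_model \<nu> g c x) y :> fd_grad \<nu> g x + (4 * c) *\<^sub>R (y - x)"
  unfolding gderiv_def quad_model_def power2_norm_eq_inner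
  by (auto intro!: derivative_eq_intros simp: fun_eq_iff inner_simps inner_commute algebra_simps)

lemma quad_model_expand:
  "quad_model \<nu> g c x y
    = quad_model \<nu> g c x z + (fd_grad \<nu> g x + (4 * c) *\<^sub>R (z - x)) \<bullet> (y - z) + 2 * c * (norm (y - z))\<^sup>2"
  unfolding quad_model_def power2_norm_eq_inner by (simp add: inner_simps inner_commute algebra_simps)

lemma continuous_on_quad_model: "continuous_on S (quad_model \<nu> g c x)"
  unfolding quad_model_def by (intro continuous_intros)

lemma quad_model_base [simp]: "quad_model \<nu> g c x x = g x"
  unfolding quad_model_def by simp

text \<open>Convexity along rays from the base point, where the model has the value
  \<open>g x\<close>.\<close>

lemma quad_model_ray:
  assumes "0 \<le> t" "t \<le> 1" "0 \<le> c"
  shows "quad_model \<nu> g c x (x + t *\<^sub>R (y - x)) \<le> (1 - t) * g x + t * quad_model \<nu> g c x y"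
proof -
  have "t\<^sup>2 * (2 * c * (norm (y - x))\<^sup>2) \<le> t * (2 * c * (norm (y - x))\<^sup>2)"
    using assms by (intro mult_right_mono) (auto simp: power2_eq_square mult_left_le_one_le)
  then show ?thesis
    unfolding quad_model_def add_diff_cancel_left' norm_scaleR power_mult_distrib
    by (simp add: algebra_simps)
qed

section \<open>Strictly feasible points and their local feasible sets\<close>

locale smooth_constraints =
  fixes f :: "'m::finite \<Rightarrow> real ^ 'n::finite \<Rightarrow> real" and L M :: "'m \<Rightarrow> real"
  assumes f_C1: "cont_diff (f i)" and L_pos: "0 < L i" and M_pos: "0 < M i"
    and f_lip: "(L i)-lipschitz_on (feasible_set f) (f i)"
    and grad_lip: "(M i)-lipschitz_on (feasible_set f) (grad (f i))"
begin

definition strict :: "real ^ 'n \<Rightarrow> bool" where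
  "strict x \<longleftrightarrow> (\<forall>i. f i x < 0)"

definition Lmax :: real where "Lmax = Max (range L)"

definition Mmax :: real where "Mmax = Max (range M)"

lemma L_le_Lmax: "L i \<le> Lmax" and M_le_Mmax: "M i \<le> Mmax"
  unfolding Lmax_def Mmax_def by auto

lemma Lmax_pos: "0 < Lmax" and Mmax_pos: "0 < Mmax"
  using L_pos[of undefined] L_le_Lmax[of undefined] M_pos[of undefined] M_le_Mmax[of undefined]
  by linarith+

lemma sd_ge_1: "1 \<le> sqrt (real CARD('n))" by (simp add: Suc_leI)

lemma strict_feasible: "strict x \<Longrightarrow> x \<in> feasible_set f"
  unfolding strict_def feasible_set_def by (auto intro: less_imp_le)

lemma safe_radius_bound: "Lmax * safe_radius f L x \<le> - f i x"
proof -
  have "Min (range (\<lambda>i. - f i x)) \<le> - f i x" by auto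
  then show ?thesis unfolding safe_radius_def Lmax_def[symmetric] using Lmax_pos by simp
qed

lemma safe_radius_pos: "strict x \<Longrightarrow> 0 < safe_radius f L x"
  unfolding safe_radius_def Lmax_def[symmetric] strict_def using Lmax_pos by simp

lemma safe_radius_ge:
  assumes "\<And>i. f i x \<le> - c"
  shows "c \<le> Lmax * safe_radius f L x"
proof -
  have "c \<le> - f i x" for i using assms[of i] by simp
  then have "c \<le> Min (range (\<lambda>i. - f i x))" by simp
  then show ?thesis unfolding safe_radius_def Lmax_def[symmetric] using Lmax_pos by simp
qed

text \<open>Within the safe radius, growth at slope \<open>Lmax\<close> cannot use up the smallest
  constraint margin. The slope is certified only between feasible points, hence the continuation
  argument.\<close>

lemma safe_ball_segment:
  assumes x: "strict x" and y: "norm (y - x) \<le> safe_radius f L x"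
  shows "closed_segment x y \<subseteq> feasible_set f"
proof (rule segment_continuation)
  show "continuous_on UNIV (f i)" for i by (rule cont_diff_continuous[OF f_C1])
  show "f i x < 0" for i using x unfolding strict_def by simp
  fix t :: real and i
  assume t: "0 < t" "t < 1" and seg: "closed_segment x (x + t *\<^sub>R (y - x)) \<subseteq> feasible_set f"
  show "f i (x + t *\<^sub>R (y - x)) < 0"
  proof -
    let ?r = "safe_radius f L x"
    have "\<bar>f i (x + t *\<^sub>R (y - x)) - f i x\<bar> \<le> L i * (t * norm (y - x))"
      using lipschitz_onD[OF f_lip[of i], of "x + t *\<^sub>R (y - x)" x] seg t
        ends_in_segment[of x "x + t *\<^sub>R (y - x)"]
      by (auto simp: dist_norm)
    also have "\<dots> \<le> L i * (t * ?r)" using L_pos[of i] t y by (intro mult_left_mono) auto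
    \<comment> \<open>Strict because \<open>t < 1\<close>; at distance exactly the safe radius a
      constraint may vanish.\<close>
    also have "\<dots> < L i * ?r" using L_pos[of i] t safe_radius_pos[OF x] by simp
    also have "\<dots> \<le> Lmax * ?r" using L_le_Lmax[of i] safe_radius_pos[OF x] by simp
    also have "\<dots> \<le> - f i x" by (rule safe_radius_bound)
    finally show ?thesis by simp
  qed
qed

text \<open>Abstracts from accuracy and iteration index, so that later bounds are uniform in both.
  The divisor sqrt(d) compensates the same factor in the finite-difference error.\<close>

definition admissible :: "real \<Rightarrow> real ^ 'n \<Rightarrow> bool" where
  "admissible \<nu> x \<longleftrightarrow> strict x \<and> 0 < \<nu> \<and> \<nu> \<le> safe_radius f L x / sqrt (real CARD('n))"

lemma admissibleD:
  assumes "admissible \<nu> x"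
  shows "strict x" "0 < \<nu>" "sqrt (real CARD('n)) * \<nu> \<le> safe_radius f L x" "\<nu> \<le> safe_radius f L x"
proof -
  show "strict x" and \<nu>: "0 < \<nu>" using assms unfolding admissible_def by auto
  have "sqrt (real CARD('n)) > 0" using sd_ge_1 by linarith
  then show sd_le: "sqrt (real CARD('n)) * \<nu> \<le> safe_radius f L x"
    using assms unfolding admissible_def by (simp add: field_simps)
  have "1 * \<nu> \<le> sqrt (real CARD('n)) * \<nu>" using \<nu> sd_ge_1 by (intro mult_right_mono) auto
  with sd_le show "\<nu> \<le> safe_radius f L x" by simp
qed

lemma sample_segment:
  assumes "admissible \<nu> x"
  shows "closed_segment x (x + \<nu> *\<^sub>R axis j 1) \<subseteq> feasible_set f"
  using admissibleD[OF assms] by (intro safe_ball_segment) (auto simp: norm_axis_1)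

lemma fd_error:
  assumes "admissible \<nu> x"
  shows "norm (fd_grad \<nu> (f i) x - grad (f i) x) \<le> sqrt (real CARD('n)) * M i / 2 * \<nu>"
  using fd_grad_error[OF f_C1 grad_lip admissibleD(2)[OF assms] sample_segment[OF assms]] .

lemma fd_grad_bound:
  assumes "admissible \<nu> x"
  shows "norm (fd_grad \<nu> (f i) x) \<le> sqrt (real CARD('n)) * L i"
proof (rule norm_le_sqrt_CARD)
  fix j
  have "\<bar>f i (x + \<nu> *\<^sub>R axis j 1) - f i x\<bar> \<le> L i * \<nu>"
    using lipschitz_onD[OF f_lip[of i], of "x + \<nu> *\<^sub>R axis j 1" x] sample_segment[OF assms, of j]
      ends_in_segment[of x "x + \<nu> *\<^sub>R axis j 1"] admissibleD(2)[OF assms]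
    by (auto simp: dist_norm norm_axis_1)
  then show "\<bar>fd_grad \<nu> (f i) x $ j\<bar> \<le> L i"
    using admissibleD(2)[OF assms] by (simp add: fd_grad_nth divide_simps)
qed

lemma fd_grad_inner_error:
  assumes "admissible \<nu> x"
  shows "\<bar>fd_grad \<nu> (f i) x \<bullet> v - grad (f i) x \<bullet> v\<bar> \<le> sqrt (real CARD('n)) * M i / 2 * \<nu> * norm v"
proof -
  have "\<bar>(fd_grad \<nu> (f i) x - grad (f i) x) \<bullet> v\<bar> \<le> norm (fd_grad \<nu> (f i) x - grad (f i) x) * norm v"
    by (rule Cauchy_Schwarz_ineq2)
  also have "\<dots> \<le> sqrt (real CARD('n)) * M i / 2 * \<nu> * norm v"
    using fd_error[OF assms] by (intro mult_right_mono) auto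
  finally show ?thesis by (simp add: inner_diff_left)
qed

text \<open>Short steps are controlled by the Lipschitz constants, long ones by the quadratic model, whose
  curvature \<open>4 * M i\<close> absorbs the error of the finite differences.\<close>

lemma constraint_after_step:
  assumes adm: "admissible \<nu> x" and seg: "closed_segment x y \<subseteq> feasible_set f"
    and q: "quad_model \<nu> (f i) (M i) x y \<le> 0"
  shows "f i y \<le> - Lmax * safe_radius f L x / 2 \<or> y \<noteq> x \<and> f i y \<le> - M i / 2 * (norm (y - x))\<^sup>2"
proof (cases "norm (y - x) < safe_radius f L x / 2")
  case True
  have "f i y - f i x \<le> L i * norm (y - x)"
    using lipschitz_onD[OF f_lip[of i], of y x] subsetD[OF seg] ends_in_segment[of x y]
    by (simp add: dist_norm abs_le_iff)
  also have "\<dots> \<le> Lmax * (safe_radius f L x / 2)"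
    using True L_le_Lmax[of i] L_pos[of i] Lmax_pos by (intro mult_mono) auto
  finally show ?thesis using safe_radius_bound[of x i] by simp
next
  case False
  \<comment> \<open>Here sqrt(d) times \<open>\<nu>\<close> is at most the safe radius, hence at
    most twice the step length. In units of \<open>M i\<close> times the squared step, finite
    differences cost at most 1 and the Taylor remainder 1/2, against 2 in the model; the surplus is
    1/2.\<close>
  have "sqrt (real CARD('n)) * \<nu> * (M i / 2 * norm (y - x)) \<le> 2 * norm (y - x) * (M i / 2 * norm (y - x))"
    using admissibleD(3)[OF adm] False M_pos[of i] by (intro mult_right_mono) auto
  then have "sqrt (real CARD('n)) * M i / 2 * \<nu> * norm (y - x) \<le> M i * (norm (y - x))\<^sup>2"
    by (simp add: power2_eq_square mult_ac)
  then have "f i y \<le> quad_model \<nu> (f i) (M i) x y - M i / 2 * (norm (y - x))\<^sup>2"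
    using fd_grad_inner_error[OF adm, of i "y - x"] taylor_lipschitz_grad[OF f_C1 seg grad_lip, of i]
    unfolding quad_model_def abs_le_iff by linarith
  moreover have "y \<noteq> x" using False safe_radius_pos[OF admissibleD(1)[OF adm]] by auto
  ultimately show ?thesis using q by auto
qed

lemma constraint_after_step_neg:
  assumes "admissible \<nu> x" "closed_segment x y \<subseteq> feasible_set f" "quad_model \<nu> (f i) (M i) x y \<le> 0"
  shows "f i y < 0"
proof -
  have "0 < Lmax * safe_radius f L x / 2"
    using Lmax_pos safe_radius_pos admissibleD(1)[OF assms(1)] by simp
  moreover have "0 < M i / 2 * (norm (y - x))\<^sup>2" if "y \<noteq> x" using M_pos[of i] that by simp
  ultimately show ?thesis using constraint_after_step[OF assms] by fastforce
qed

lemma local_set_iff: "y \<in> local_set \<nu> f M x \<longleftrightarrow> (\<forall>i. quad_model \<nu> (f i) (M i) x y \<le> 0)"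
  unfolding local_set_def by auto

lemma local_set_base: "strict x \<Longrightarrow> x \<in> local_set \<nu> f M x"
  unfolding local_set_iff strict_def by (auto intro: less_imp_le)

lemma local_set_ray:
  assumes "strict x" "y \<in> local_set \<nu> f M x" "0 \<le> t" "t \<le> 1"
  shows "x + t *\<^sub>R (y - x) \<in> local_set \<nu> f M x"
  unfolding local_set_iff
proof
  fix i
  have "(1 - t) * f i x \<le> 0" "t * quad_model \<nu> (f i) (M i) x y \<le> 0"
    using assms unfolding local_set_iff strict_def
    by (auto simp: mult_le_0_iff zero_le_mult_iff intro: less_imp_le)
  then show "quad_model \<nu> (f i) (M i) x (x + t *\<^sub>R (y - x)) \<le> 0"
    using quad_model_ray[of t "M i" \<nu> "f i" x y] assms(3,4) M_pos[of i] by linarith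
qed

text \<open>By convexity partial steps stay in the local set, so each is strictly feasible as soon
  as the segment up to it is feasible. This is exactly what the continuation argument asks
  for.\<close>

lemma local_set_segment:
  assumes adm: "admissible \<nu> x" and y: "y \<in> local_set \<nu> f M x"
  shows "closed_segment x y \<subseteq> feasible_set f"
proof (rule segment_continuation)
  show "continuous_on UNIV (f i)" for i by (rule cont_diff_continuous[OF f_C1])
  show "f i x < 0" for i using admissibleD(1)[OF adm] unfolding strict_def by simp
  fix t :: real and i
  assume "0 < t" "t < 1" and seg: "closed_segment x (x + t *\<^sub>R (y - x)) \<subseteq> feasible_set f"
  then show "f i (x + t *\<^sub>R (y - x)) < 0"
    using constraint_after_step_neg[OF adm seg] local_set_ray[OF admissibleD(1)[OF adm] y, of t]
    unfolding local_set_iff by auto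
qed

lemma local_set_strict:
  assumes "admissible \<nu> x" "y \<in> local_set \<nu> f M x"
  shows "strict y"
  using constraint_after_step_neg[OF assms(1) local_set_segment[OF assms]] assms(2)
  unfolding strict_def local_set_iff by auto

lemma compact_local_set: "compact (local_set \<nu> f M x)"
  unfolding compact_eq_bounded_closed
proof
  fix i :: 'm
  define B where "B = norm (fd_grad \<nu> (f i) x) + \<bar>f i x\<bar>"
  \<comment> \<open>One constraint suffices, its quadratic term being coercive. The summand 1 forces
    a distant \<open>y\<close> to have distance above 1, so that the constant term too is bounded by
    a multiple of the distance.\<close>
  have "norm (y - x) \<le> B / (2 * M i) + 1" if "y \<in> local_set \<nu> f M x" for y
  proof (rule ccontr)
    assume far: "\<not> ?thesis"
    let ?n = "norm (y - x)"
    have B: "0 \<le> B / (2 * M i)" using M_pos[of i] unfolding B_def by simp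
    then have n: "1 < ?n" using far by linarith
    have "B / (2 * M i) < ?n" using far by linarith
    then have Bn: "B < 2 * M i * ?n" using M_pos[of i] by (simp add: field_simps)
    have "- (norm (fd_grad \<nu> (f i) x) * ?n) \<le> fd_grad \<nu> (f i) x \<bullet> (y - x)"
      using Cauchy_Schwarz_ineq2[of "fd_grad \<nu> (f i) x" "y - x"] by simp
    moreover have "- (\<bar>f i x\<bar> * ?n) \<le> f i x"
      using mult_left_mono[of 1 ?n "\<bar>f i x\<bar>"] n by simp
    ultimately have "- (B * ?n) + 2 * M i * ?n\<^sup>2 \<le> quad_model \<nu> (f i) (M i) x y"
      unfolding quad_model_def B_def by (simp add: algebra_simps)
    also have "\<dots> \<le> 0" using that unfolding local_set_iff by simp
    finally have "2 * M i * ?n * ?n \<le> B * ?n" by (simp add: power2_eq_square)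
    moreover have "B * ?n < 2 * M i * ?n * ?n" using Bn n by (intro mult_strict_right_mono) auto
    ultimately show False by linarith
  qed
  then have "local_set \<nu> f M x \<subseteq> cball x (B / (2 * M i) + 1)" by (auto simp: dist_norm norm_minus_commute)
  then show "bounded (local_set \<nu> f M x)" by (rule bounded_subset[OF bounded_cball])
  have "closed {y. quad_model \<nu> (f i) (M i) x y \<le> 0}" for i
    by (intro closed_Collect_le continuous_on_quad_model continuous_intros)
  then show "closed (local_set \<nu> f M x)" unfolding local_set_def by (intro closed_INT) auto
qed

text \<open>The ball depends on the margin \<open>c\<close> but not on the radius, because
  finite-difference gradients are bounded by sqrt(d) times \<open>Lmax\<close> for every admissible
  \<open>\<nu>\<close>. Capping at 1 lets the linear term control the quadratic one.\<close>

lemma local_set_ball: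
  assumes "0 < c"
  obtains \<rho> where "0 < \<rho>" "\<And>\<nu> x y. admissible \<nu> x \<Longrightarrow> (\<And>i. f i x \<le> - c) \<Longrightarrow> norm (y - x) \<le> \<rho> \<Longrightarrow>
    y \<in> local_set \<nu> f M x"
proof
  have D: "0 < sqrt (real CARD('n)) * Lmax + 2 * Mmax"
    using Lmax_pos Mmax_pos by (intro add_nonneg_pos) auto
  then show "0 < min 1 (c / (sqrt (real CARD('n)) * Lmax + 2 * Mmax))" using assms by simp
  fix \<nu> x y
  assume adm: "admissible \<nu> x" and c: "\<And>i. f i x \<le> - c"
    and y: "norm (y - x) \<le> min 1 (c / (sqrt (real CARD('n)) * Lmax + 2 * Mmax))"
  show "y \<in> local_set \<nu> f M x"
    unfolding local_set_iff
  proof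
    fix i
    let ?n = "norm (y - x)"
    have "?n \<le> c / (sqrt (real CARD('n)) * Lmax + 2 * Mmax)" using y by simp
    then have n: "?n \<le> 1" "(sqrt (real CARD('n)) * Lmax + 2 * Mmax) * ?n \<le> c"
      using y D by (auto simp: field_simps)
    have "fd_grad \<nu> (f i) x \<bullet> (y - x) \<le> norm (fd_grad \<nu> (f i) x) * ?n" by (rule norm_cauchy_schwarz)
    also have "\<dots> \<le> sqrt (real CARD('n)) * L i * ?n" using fd_grad_bound[OF adm] by (intro mult_right_mono) auto
    also have "\<dots> \<le> sqrt (real CARD('n)) * Lmax * ?n" using L_le_Lmax[of i] by (intro mult_right_mono mult_left_mono) auto
    finally have 1: "fd_grad \<nu> (f i) x \<bullet> (y - x) \<le> sqrt (real CARD('n)) * Lmax * ?n" .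
    have "?n\<^sup>2 \<le> ?n" using n(1) by (simp add: power2_eq_square mult_left_le)
    then have "2 * M i * ?n\<^sup>2 \<le> 2 * Mmax * ?n"
      using M_le_Mmax[of i] M_pos[of i] Mmax_pos by (intro mult_mono) auto
    then show "quad_model \<nu> (f i) (M i) x y \<le> 0"
      unfolding quad_model_def using 1 n(2) c[of i] by (simp add: algebra_simps)
  qed
qed

end

section \<open>One step of the method as a relation between successive points\<close>

locale szo_problem = smooth_constraints f L M
  for f :: "'m::finite \<Rightarrow> real ^ 'n::finite \<Rightarrow> real" and L M :: "'m \<Rightarrow> real" +
  fixes f0 :: "real ^ 'n \<Rightarrow> real" and g :: "real ^ 'n" and \<mu> :: real
  assumes f0_inner: "f0 y = g \<bullet> y" and \<mu>_pos: "0 < \<mu>"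
begin

definition szo_step :: "real \<Rightarrow> real ^ 'n \<Rightarrow> real ^ 'n \<Rightarrow> bool" where
  "szo_step \<nu> x y \<longleftrightarrow> admissible \<nu> x \<and> y \<in> local_set \<nu> f M x \<and>
     (\<forall>z \<in> local_set \<nu> f M x. f0 y + \<mu> * (norm (y - x))\<^sup>2 \<le> f0 z + \<mu> * (norm (z - x))\<^sup>2)"

lemma szo_stepD:
  assumes "szo_step \<nu> x y"
  shows "admissible \<nu> x" "strict x" "strict y" "closed_segment x y \<subseteq> feasible_set f"
    "y \<in> local_set \<nu> f M x"
    "z \<in> local_set \<nu> f M x \<Longrightarrow> f0 y + \<mu> * (norm (y - x))\<^sup>2 \<le> f0 z + \<mu> * (norm (z - x))\<^sup>2"
  using assms local_set_strict local_set_segment admissibleD(1) unfolding szo_step_def by blast+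

lemma szo_step_arg_min:
  assumes adm: "admissible \<nu> x"
  shows "szo_step \<nu> x (arg_min_on (\<lambda>y. f0 y + \<mu> * (norm (y - x))\<^sup>2) (local_set \<nu> f M x))"
proof -
  let ?S = "local_set \<nu> f M x" and ?F = "\<lambda>y. f0 y + \<mu> * (norm (y - x))\<^sup>2"
  have "continuous_on ?S ?F" unfolding f0_inner by (intro continuous_intros)
  moreover have "?S \<noteq> {}" using local_set_base admissibleD(1)[OF adm] by auto
  ultimately obtain y where y: "y \<in> ?S" "\<forall>z\<in>?S. ?F y \<le> ?F z"
    using continuous_attains_inf[OF compact_local_set] by blast
  then have "is_arg_min ?F (\<lambda>x. x \<in> ?S) y" unfolding is_arg_min_linorder by simp
  then have "is_arg_min ?F (\<lambda>x. x \<in> ?S) (arg_min_on ?F ?S)"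
    unfolding arg_min_on_def arg_min_def by (rule someI)
  then show ?thesis using adm unfolding is_arg_min_linorder szo_step_def by simp
qed

lemma szo_step_decrease:
  assumes "szo_step \<nu> x y"
  shows "f0 y + \<mu> * (norm (y - x))\<^sup>2 \<le> f0 x"
  using szo_stepD(6)[OF assms local_set_base] szo_stepD(2)[OF assms] by simp

text \<open>The minimizer is compared with a trial point at distance \<open>\<tau>\<close> in the
  direction of steepest descent. A decrease of \<open>f0\<close> comparable to that of the trial
  point needs a step of comparable length, by Cauchy-Schwarz.\<close>

lemma szo_step_length:
  assumes g: "g \<noteq> 0" and c: "0 < c"
  obtains s where "0 < s"
    "\<And>\<nu> x y. szo_step \<nu> x y \<Longrightarrow> (\<And>i. f i x \<le> - c) \<Longrightarrow> s \<le> norm (y - x)"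
proof -
  obtain \<rho> where \<rho>: "0 < \<rho>" "\<And>\<nu> x y. admissible \<nu> x \<Longrightarrow> (\<And>i. f i x \<le> - c) \<Longrightarrow> norm (y - x) \<le> \<rho> \<Longrightarrow>
      y \<in> local_set \<nu> f M x"
    by (rule local_set_ball[OF c]) blast
  \<comment> \<open>The first bound keeps the trial point in the local set; the second makes the
    penalty at most half of the gain \<open>\<tau> * norm g\<close>.\<close>
  define \<tau> where "\<tau> = min \<rho> (norm g / (2 * \<mu>))"
  have \<tau>: "0 < \<tau>" unfolding \<tau>_def using \<rho>(1) \<mu>_pos g by simp
  show ?thesis
  proof (rule that[of "\<tau> / 2"])
    show "0 < \<tau> / 2" using \<tau> by simp
    fix \<nu> x y
    assume step: "szo_step \<nu> x y" and cx: "\<And>i. f i x \<le> - c"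
    define z where "z = x - (\<tau> / norm g) *\<^sub>R g"
    have zx: "norm (z - x) = \<tau>" unfolding z_def using g \<tau> by simp
    have "z \<in> local_set \<nu> f M x"
      using \<rho>(2)[OF szo_stepD(1)[OF step] cx] zx unfolding \<tau>_def by simp
    from szo_stepD(6)[OF step this] have "f0 y \<le> f0 z + \<mu> * \<tau>\<^sup>2"
      using \<mu>_pos zx zero_le_power2[of "norm (y - x)"] by (smt (verit) mult_nonneg_nonneg)
    also have "f0 z = f0 x - \<tau> * norm g"
      unfolding f0_inner z_def using g by (simp add: inner_diff_right dot_square_norm power2_eq_square)
    also have "\<mu> * \<tau>\<^sup>2 \<le> \<tau> * norm g / 2"
    proof -
      have "\<tau> \<le> norm g / (2 * \<mu>)" unfolding \<tau>_def by simp
      then have "\<mu> * \<tau> \<le> norm g / 2" using \<mu>_pos by (simp add: field_simps)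
      from mult_right_mono[OF this, of \<tau>] \<tau> show ?thesis by (simp add: power2_eq_square mult_ac)
    qed
    finally have "f0 y \<le> f0 x - \<tau> * norm g / 2" by simp
    moreover have "f0 x - f0 y \<le> norm g * norm (y - x)"
      using norm_cauchy_schwarz[of g "x - y"] unfolding f0_inner
      by (simp add: inner_diff_right norm_minus_commute)
    ultimately have "norm g * (\<tau> / 2) \<le> norm g * norm (y - x)" by (simp add: mult.commute)
    then show "\<tau> / 2 \<le> norm (y - x)" using g by simp
  qed
qed

text \<open>By linearity, a long step would push \<open>f0\<close> below \<open>f0 xc\<close> at a feasible point near \<open>xc\<close>.\<close>

lemma szo_step_trapped:
  assumes step: "szo_step \<nu> x y" and r: "0 < r"
    and loc: "\<And>z. z \<in> feasible_set f \<Longrightarrow> norm (z - xc) \<le> r \<Longrightarrow> f0 xc \<le> f0 z"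
    and x: "norm (x - xc) \<le> r / 2" "f0 x < f0 xc + \<mu> * (r / 2)\<^sup>2"
  shows "norm (y - x) < r / 2"
proof (rule ccontr)
  assume long: "\<not> ?thesis"
  define n where "n = norm (y - x)"
  have n: "r / 2 \<le> n" "0 < n" using long r unfolding n_def by auto
  \<comment> \<open>At this fraction the segment has covered exactly \<open>r / 2\<close>. By
    linearity the fraction \<open>t\<close> of the total decrease, at least
    \<open>\<mu> * (r / 2)\<^sup>2\<close>, has been realized there.\<close>
  define t where "t = (r / 2) / n"
  have t: "0 \<le> t" "t \<le> 1" unfolding t_def using n r by auto
  define z where "z = x + t *\<^sub>R (y - x)"
  have "norm (z - x) = r / 2" unfolding z_def t_def using n r by (simp add: n_def[symmetric])
  then have "norm (z - xc) \<le> r" using norm_triangle_ineq[of "z - x" "x - xc"] x(1) by simp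
  moreover have "z \<in> feasible_set f"
    using szo_stepD(4)[OF step] in_closed_segment_ray[OF t] unfolding z_def by blast
  ultimately have "f0 xc \<le> f0 z" by (intro loc)
  moreover have "f0 z = f0 x - t * (f0 x - f0 y)"
    unfolding f0_inner z_def by (simp add: inner_simps algebra_simps)
  moreover have "t * (\<mu> * n\<^sup>2) \<le> t * (f0 x - f0 y)"
    using szo_step_decrease[OF step] t(1) unfolding n_def by (intro mult_left_mono) auto
  moreover have "\<mu> * (r / 2)\<^sup>2 \<le> t * (\<mu> * n\<^sup>2)"
  proof -
    have "t * n = r / 2" unfolding t_def using n by simp
    then have "t * (\<mu> * n\<^sup>2) = \<mu> * (r / 2) * n" by (metis mult.assoc mult.commute power2_eq_square)
    moreover have "\<mu> * (r / 2) * (r / 2) \<le> \<mu> * (r / 2) * n" using n r \<mu>_pos by (intro mult_left_mono) auto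
    ultimately show ?thesis by (simp only: power2_eq_square mult.assoc)
  qed
  ultimately show False using x(2) by linarith
qed

text \<open>The base point \<open>x\<close> is a Slater point of the subproblem: each model takes
  the value \<open>f i x\<close> there, which is negative. The models are convex, so Slater's
  condition yields the constraint qualification.\<close>

lemma szo_step_multipliers:
  assumes step: "szo_step \<nu> x y"
  obtains l :: "real ^ 'm" where "\<And>i. 0 \<le> l $ i" "\<And>i. l $ i * quad_model \<nu> (f i) (M i) x y = 0"
    "(g + (2 * \<mu>) *\<^sub>R (y - x)) + (\<Sum>i\<in>UNIV. (l $ i) *\<^sub>R (fd_grad \<nu> (f i) x + (4 * M i) *\<^sub>R (y - x))) = 0"
proof (rule kkt_multipliers)
  show "GDERIV (\<lambda>z. f0 z + \<mu> * (norm (z - x))\<^sup>2) y :> g + (2 * \<mu>) *\<^sub>R (y - x)"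
    unfolding gderiv_def f0_inner power2_norm_eq_inner
    by (auto intro!: derivative_eq_intros simp: fun_eq_iff inner_simps inner_commute algebra_simps)
  show "GDERIV (quad_model \<nu> (f i) (M i) x) y :> fd_grad \<nu> (f i) x + (4 * M i) *\<^sub>R (y - x)" for i
    by (rule quad_model_GDERIV)
  show "quad_model \<nu> (f i) (M i) x y \<le> 0" for i using szo_stepD(5)[OF step] unfolding local_set_iff by simp
  show "\<forall>\<^sub>F z in nhds y. (\<forall>i. quad_model \<nu> (f i) (M i) x z \<le> 0) \<longrightarrow>
      f0 y + \<mu> * (norm (y - x))\<^sup>2 \<le> f0 z + \<mu> * (norm (z - x))\<^sup>2"
    using szo_stepD(6)[OF step] unfolding local_set_iff by simp
next
  fix w :: "'m \<Rightarrow> real" and j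
  let ?G = "\<lambda>i. fd_grad \<nu> (f i) x + (4 * M i) *\<^sub>R (y - x)"
  assume w: "\<And>i. 0 \<le> w i" "\<And>i. w i * quad_model \<nu> (f i) (M i) x y = 0"
    "(\<Sum>i\<in>UNIV. w i *\<^sub>R ?G i) = 0"
  have wx: "w i * f i x \<le> 0" for i
    using w(1)[of i] szo_stepD(2)[OF step] unfolding strict_def
    by (auto simp: mult_le_0_iff intro: less_imp_le)
  \<comment> \<open>Pairing the vanishing combination with \<open>x - y\<close> and using convexity
    gives that the sum of the nonpositive terms \<open>w i * f i x\<close> is at least 0, so every
    term vanishes.\<close>
  have "0 = (\<Sum>i\<in>UNIV. w i *\<^sub>R ?G i) \<bullet> (x - y)" using w(3) by simp
  also have "\<dots> = (\<Sum>i\<in>UNIV. w i * (?G i \<bullet> (x - y)))" by (simp add: inner_sum_left)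
  also have "\<dots> \<le> (\<Sum>i\<in>UNIV. w i * f i x)"
  proof (rule sum_mono)
    fix i
    have "f i x = quad_model \<nu> (f i) (M i) x y + ?G i \<bullet> (x - y) + 2 * M i * (norm (x - y))\<^sup>2"
      using quad_model_expand[of \<nu> "f i" "M i" x x y] by simp
    then have "w i * f i x = w i * quad_model \<nu> (f i) (M i) x y + w i * (?G i \<bullet> (x - y))
        + w i * (2 * M i * (norm (x - y))\<^sup>2)" by (simp only: distrib_left)
    moreover have "0 \<le> w i * (2 * M i * (norm (x - y))\<^sup>2)" using w(1)[of i] M_pos[of i] by simp
    ultimately show "w i * (?G i \<bullet> (x - y)) \<le> w i * f i x" using w(2)[of i] by linarith
  qed
  finally have "(\<Sum>i\<in>UNIV. w i * f i x) = 0" using sum_nonpos[of UNIV "\<lambda>i. w i * f i x"] wx by force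
  then have "w j * f j x = 0" using sum_nonneg_eq_0_iff[of UNIV "\<lambda>i. - (w i * f i x)"] wx
    by (simp add: sum_negf)
  moreover have "f j x \<noteq> 0" using szo_stepD(2)[OF step] unfolding strict_def by (metis less_irrefl)
  ultimately show "w j = 0" by simp
qed (rule that)

end

section \<open>Iterates and termination\<close>

declare szo_iterate.simps(2) [simp del]

lemma eventually_small_multiple: "0 < d \<Longrightarrow> \<forall>\<^sub>F \<rho> in at_right 0. c * \<rho> < (d :: real)"
proof -
  have "((\<lambda>\<rho>. c * \<rho>) \<longlongrightarrow> 0) (at_right 0)" by (auto intro!: tendsto_eq_intros)
  then show "0 < d \<Longrightarrow> ?thesis" by (rule order_tendstoD(2))
qed

lemma alpha_max_eq: "alpha_max d M = sqrt (real d) * Max (range M) / 2"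
proof -
  have "mono (\<lambda>r. sqrt (real d) * r / 2)" by (auto intro!: monoI mult_left_mono divide_right_mono)
  from mono_Max_commute[OF this, of "range M"] show ?thesis
    unfolding alpha_max_def by (simp add: image_image)
qed

lemma multipliers_iff:
  fixes l :: "real ^ 'm::finite"
  shows "l \<in> multipliers f0 f M \<mu> \<eta> \<nu> x y \<longleftrightarrow>
    (\<forall>i. 0 \<le> l $ i) \<and> delta1 f0 f M \<mu> \<nu> x y l \<le> \<eta> / 2 \<and> (\<forall>i. delta2 f M \<nu> x y l i \<le> \<eta> / 2)"
  unfolding multipliers_def mem_Collect_eq max.bounded_iff by (subst Max_le_iff) auto

lemma closed_multipliers:
  fixes f :: "'m::finite \<Rightarrow> real ^ 'n::finite \<Rightarrow> real"
  shows "closed (multipliers f0 f M \<mu> \<eta> \<nu> x y)"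
proof -
  have "multipliers f0 f M \<mu> \<eta> \<nu> x y = (\<Inter>i. {l. 0 \<le> l $ i}) \<inter> {l. delta1 f0 f M \<mu> \<nu> x y l \<le> \<eta> / 2}
      \<inter> (\<Inter>i. {l. delta2 f M \<nu> x y l i \<le> \<eta> / 2})"
    by (auto simp: multipliers_iff)
  moreover have "closed (\<Inter>i. {l :: real ^ 'm. 0 \<le> l $ i})"
    by (auto intro!: closed_INT closed_Collect_le continuous_intros)
  moreover have "closed {l. delta1 f0 f M \<mu> \<nu> x y l \<le> \<eta> / 2}"
    unfolding delta1_def by (intro closed_Collect_le continuous_intros)
  moreover have "closed (\<Inter>i. {l. delta2 f M \<nu> x y l i \<le> \<eta> / 2})"
    unfolding delta2_def by (auto intro!: closed_INT closed_Collect_le continuous_intros)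
  ultimately show ?thesis by auto
qed

lemma infnorm_le_iff: "infnorm (l :: real ^ 'm::finite) \<le> b \<longleftrightarrow> (\<forall>i. \<bar>l $ i\<bar> \<le> b)"
proof
  assume "infnorm l \<le> b"
  then show "\<forall>i. \<bar>l $ i\<bar> \<le> b" using component_le_infnorm_cart[of l] order_trans by blast
next
  assume "\<forall>i. \<bar>l $ i\<bar> \<le> b"
  then show "infnorm l \<le> b" unfolding infnorm_cart by (intro cSup_least) auto
qed

text \<open>The minimization can be restricted to a sublevel set of \<open>infnorm\<close>, compact
  even if \<open>S\<close> is unbounded. The selected multiplier inherits the bound of any known
  one.\<close>

lemma infnorm_arg_min_exists:
  fixes S :: "(real ^ 'm::finite) set"
  assumes S: "closed S" and l: "l \<in> S" "infnorm l \<le> b"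
  obtains l' where "is_arg_min infnorm (\<lambda>l. l \<in> S) l'" "infnorm l' \<le> b"
proof -
  define T where "T = S \<inter> {l. infnorm l \<le> b}"
  have "closed {l :: real ^ 'm. infnorm l \<le> b}" by (intro closed_Collect_le continuous_intros)
  then have "closed T" unfolding T_def using S by blast
  moreover have "bounded T"
  proof (rule boundedI)
    fix l assume "l \<in> T"
    then show "norm l \<le> sqrt (real CARD('m)) * b"
      unfolding T_def by (intro norm_le_sqrt_CARD) (auto simp: infnorm_le_iff)
  qed
  ultimately have "compact T" by (simp add: compact_eq_bounded_closed)
  moreover have "T \<noteq> {}" using l unfolding T_def by auto
  moreover have "continuous_on T infnorm" by (intro continuous_intros)
  ultimately obtain l' where l': "l' \<in> T" "\<forall>l\<in>T. infnorm l' \<le> infnorm l"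
    using continuous_attains_inf by blast
  have "infnorm l' \<le> infnorm l" if "l \<in> S" for l
    using l' that unfolding T_def by (cases "infnorm l \<le> b") auto
  with l' show ?thesis using that unfolding T_def is_arg_min_linorder by auto
qed

section \<open>Iterates of the algorithm, with bounds uniform in the accuracy\<close>

locale szo_algorithm = szo_problem f L M f0 g \<mu>
  for f :: "'m::finite \<Rightarrow> real ^ 'n::finite \<Rightarrow> real" and L M :: "'m \<Rightarrow> real"
    and f0 :: "real ^ 'n \<Rightarrow> real" and g :: "real ^ 'n" and \<mu> :: real +
  fixes \<Lambda> :: real and x0 :: "real ^ 'n"
  assumes \<Lambda>_pos: "0 < \<Lambda>" and x0_strict: "strict x0"
begin

abbreviation X :: "real \<Rightarrow> nat \<Rightarrow> real ^ 'n" where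
  "X \<equiv> szo_iterate f0 f L M \<mu> \<Lambda> x0"

abbreviation radius :: "real \<Rightarrow> nat \<Rightarrow> real" where
  "radius \<eta> k \<equiv> sampling_radius f L M \<Lambda> \<eta> k (X \<eta> k)"

lemma alpha_max_pos: "0 < alpha_max CARD('n) M"
  unfolding alpha_max_eq Mmax_def[symmetric] using Mmax_pos by simp

lemma sampling_radius_le:
  "sampling_radius f L M \<Lambda> \<eta> k x \<le> safe_radius f L x / sqrt (real CARD('n))"
  "sampling_radius f L M \<Lambda> \<eta> k x \<le> \<eta> / (12 * alpha_max CARD('n) M * real CARD('m) * \<Lambda>)"
  "k \<noteq> 0 \<Longrightarrow> sampling_radius f L M \<Lambda> \<eta> k x \<le> 1 / real k"
  unfolding sampling_radius_def by (intro Min_le; auto)+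

lemma sampling_radius_admissible:
  assumes "strict x" "0 < \<eta>"
  shows "admissible (sampling_radius f L M \<Lambda> \<eta> k x) x"
  unfolding admissible_def
proof (intro conjI)
  show "0 < sampling_radius f L M \<Lambda> \<eta> k x"
    unfolding sampling_radius_def
    using assms safe_radius_pos[OF assms(1)] alpha_max_pos \<Lambda>_pos by (subst Min_gr_iff) auto
qed (use assms sampling_radius_le(1) in auto)

lemma iterate_Suc:
  assumes "strict (X \<eta> k)" "0 < \<eta>"
  shows "szo_step (radius \<eta> k) (X \<eta> k) (X \<eta> (Suc k))"
  using szo_step_arg_min[OF sampling_radius_admissible[OF assms, of k]] 
  by (simp add: Let_def szo_iterate.simps(2))

lemma iterate_strict: "0 < \<eta> \<Longrightarrow> strict (X \<eta> k)"
proof (induction k)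
  case (Suc k)
  then show ?case using szo_stepD(3)[OF iterate_Suc] by blast
qed (simp add: x0_strict)

lemma iterate_step: "0 < \<eta> \<Longrightarrow> szo_step (radius \<eta> k) (X \<eta> k) (X \<eta> (Suc k))"
  by (simp add: iterate_Suc iterate_strict)

lemma iterate_descent:
  assumes "0 < \<eta>"
  shows "(\<Sum>j<k. \<mu> * (norm (X \<eta> (Suc j) - X \<eta> j))\<^sup>2) \<le> f0 x0 - f0 (X \<eta> k)"
proof (induction k)
  case (Suc k)
  then show ?case using szo_step_decrease[OF iterate_step[OF assms, of k]]
    by simp
qed simp

text \<open>The quantifier order is the point: strict feasibility holds for each accuracy, but
  \<open>c\<close> must serve all of them. A margin gives a lower bound on the next step length,
  which in turn gives the next margin.\<close>

lemma iterate_margin: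
  assumes g: "g \<noteq> 0"
  shows "\<exists>c>0. \<forall>\<eta>>0. \<forall>i. f i (X \<eta> k) \<le> - c"
proof (induction k)
  case 0
  define c where "c = Min (range (\<lambda>i. - f i x0))"
  have "c \<le> - f i x0" for i unfolding c_def by simp
  then have "f i x0 \<le> - c" for i by (simp add: le_minus_iff)
  moreover have "0 < c" unfolding c_def using x0_strict unfolding strict_def by simp
  ultimately show ?case by auto
next
  case (Suc k)
  then obtain c where c: "0 < c" "\<And>\<eta> i. 0 < \<eta> \<Longrightarrow> f i (X \<eta> k) \<le> - c" by blast
  obtain s where s: "0 < s" "\<And>\<nu> x y. szo_step \<nu> x y \<Longrightarrow> (\<And>i. f i x \<le> - c) \<Longrightarrow> s \<le> norm (y - x)"
    by (rule szo_step_length[OF g c(1)]) blast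
  \<comment> \<open>The two entries answer the two alternatives of
    \<open>constraint_after_step\<close>.\<close>
  define c' where "c' = min (c / 2) (Min (range M) / 2 * s\<^sup>2)"
  have "0 < c'" unfolding c'_def using c s M_pos by simp
  moreover have "f i (X \<eta> (Suc k)) \<le> - c'" if \<eta>: "0 < \<eta>" for \<eta> i
  proof -
    let ?x = "X \<eta> k" and ?y = "X \<eta> (Suc k)"
    note st = iterate_step[OF \<eta>, of k]
    have "quad_model (radius \<eta> k) (f i) (M i) ?x ?y \<le> 0"
      using szo_stepD(5)[OF st] unfolding local_set_iff by simp
    note cases = constraint_after_step[OF szo_stepD(1,4)[OF st] this]
    have "c \<le> Lmax * safe_radius f L ?x" using c(2)[OF \<eta>] by (rule safe_radius_ge)
    then have 1: "- Lmax * safe_radius f L ?x / 2 \<le> - c'" unfolding c'_def by simp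
    have "s\<^sup>2 \<le> (norm (?y - ?x))\<^sup>2" using s(2)[OF st c(2)[OF \<eta>]] s(1) by (intro power_mono) auto
    then have "Min (range M) / 2 * s\<^sup>2 \<le> M i / 2 * (norm (?y - ?x))\<^sup>2"
      using M_pos[of i] by (intro mult_mono divide_right_mono) auto
    then have "- M i / 2 * (norm (?y - ?x))\<^sup>2 \<le> - c'" unfolding c'_def by simp
    with cases 1 show ?thesis by linarith
  qed
  ultimately show ?case by blast
qed

text \<open>Only finitely many indices occur, so the minimum of their lower bounds, each uniform in
  the accuracy, stays positive.\<close>

lemma early_steps_long:
  assumes g: "g \<noteq> 0"
  shows "\<exists>s>0. \<forall>k<K. \<forall>\<eta>>0. s \<le> norm (X \<eta> (Suc k) - X \<eta> k)"
proof (induction K)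
  case 0
  show ?case by (intro exI[of _ 1]) simp
next
  case (Suc K)
  then obtain s where s: "0 < s" "\<And>k \<eta>. k < K \<Longrightarrow> 0 < \<eta> \<Longrightarrow> s \<le> norm (X \<eta> (Suc k) - X \<eta> k)" by blast
  obtain c where c: "0 < c" "\<And>\<eta> i. 0 < \<eta> \<Longrightarrow> f i (X \<eta> K) \<le> - c"
    using iterate_margin[OF g, of K] by blast
  obtain s' where s': "0 < s'" "\<And>\<nu> x y. szo_step \<nu> x y \<Longrightarrow> (\<And>i. f i x \<le> - c) \<Longrightarrow> s' \<le> norm (y - x)"
    by (rule szo_step_length[OF g c(1)]) blast
  have "min s s' \<le> norm (X \<eta> (Suc k) - X \<eta> k)" if "k < Suc K" "0 < \<eta>" for k \<eta>
    using s(2)[of k \<eta>] s'(2)[OF iterate_step[OF that(2)] c(2)[OF that(2)]] that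
    by (cases "k = K") (auto simp: less_Suc_eq)
  then show ?case using s(1) s'(1) by (intro exI[of _ "min s s'"]) simp
qed

text \<open>Every step before the first short one consumes at least \<open>\<mu> * h\<^sup>2\<close>
  of the optimality gap. The step with index \<open>k\<close> is iteration \<open>k + 1\<close>, the
  origin of the added 1 in the iteration bound.\<close>

lemma short_step_exists:
  assumes \<eta>: "0 < \<eta>" and h: "0 < h" and bdd: "bdd_below (f0 ` feasible_set f)"
  obtains k where "norm (X \<eta> (Suc k) - X \<eta> k) \<le> h"
    "real k \<le> (f0 x0 - (INF x\<in>feasible_set f. f0 x)) / (\<mu> * h\<^sup>2)"
proof -
  define short where "short k \<longleftrightarrow> norm (X \<eta> (Suc k) - X \<eta> k) \<le> h" for k
  define gap where "gap = f0 x0 - (INF x\<in>feasible_set f. f0 x)"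
  have \<mu>h: "0 < \<mu> * h\<^sup>2" using \<mu>_pos h by simp
  have bound: "real k \<le> gap / (\<mu> * h\<^sup>2)" if long: "\<And>j. j < k \<Longrightarrow> \<not> short j" for k
  proof -
    have "h \<le> norm (X \<eta> (Suc j) - X \<eta> j)" if "j < k" for j
      using long[OF that] unfolding short_def by simp
    then have le: "\<mu> * h\<^sup>2 \<le> \<mu> * (norm (X \<eta> (Suc j) - X \<eta> j))\<^sup>2" if "j < k" for j
      using that \<mu>_pos h by (intro mult_left_mono power_mono) auto
    have "real k * (\<mu> * h\<^sup>2) = (\<Sum>j<k. \<mu> * h\<^sup>2)" by simp
    also have "\<dots> \<le> (\<Sum>j<k. \<mu> * (norm (X \<eta> (Suc j) - X \<eta> j))\<^sup>2)"
      using le by (intro sum_mono) simp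
    also have "\<dots> \<le> f0 x0 - f0 (X \<eta> k)" by (rule iterate_descent[OF \<eta>])
    also have "\<dots> \<le> gap"
      unfolding gap_def using cINF_lower[OF bdd strict_feasible[OF iterate_strict[OF \<eta>, of k]]] by simp
    finally show ?thesis using \<mu>h by (simp add: field_simps)
  qed
  have "\<exists>k. short k"
  proof (rule ccontr)
    assume "\<nexists>k. short k"
    then have "real k \<le> gap / (\<mu> * h\<^sup>2)" for k using bound by blast
    moreover obtain k where "gap / (\<mu> * h\<^sup>2) < real k" using reals_Archimedean2 by blast
    ultimately show False by (metis not_less)
  qed
  then have "short (LEAST k. short k)" "\<And>j. j < (LEAST k. short k) \<Longrightarrow> \<not> short j"
    by (auto intro: LeastI_ex dest: not_less_Least)
  with bound show ?thesis using that unfolding short_def gap_def by blast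
qed

text \<open>On the feasible part of an annulus around \<open>xc\<close>, compactness and strict
  minimality keep \<open>f0\<close> a fixed amount above \<open>f0 xc\<close>. An iterate inside
  with smaller value cannot jump across the annulus nor, by descent, land in it. \<open>K0\<close>
  lets the caller demand a late index, hence a small radius.\<close>

lemma eventually_trapped:
  assumes acc: "accumulation_point X xc" and min: "strict_local_minimizer f0 (feasible_set f) xc"
    and r: "0 < r"
  obtains K \<eta>1 where "0 < \<eta>1" "K0 \<le> K"
    "\<And>\<eta> k. 0 < \<eta> \<Longrightarrow> \<eta> < \<eta>1 \<Longrightarrow> K \<le> k \<Longrightarrow> norm (X \<eta> k - xc) < r"
proof -
  obtain N where N: "open N" "xc \<in> N" "\<And>z. z \<in> N \<Longrightarrow> z \<in> feasible_set f \<Longrightarrow> z \<noteq> xc \<Longrightarrow> f0 xc < f0 z"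
    using min unfolding strict_local_minimizer_def by blast
  obtain R0 where R0: "0 < R0" "cball xc R0 \<subseteq> N"
    using N open_contains_cball by blast
  define R where "R = min R0 r"
  have R: "0 < R" "R \<le> r" unfolding R_def using R0 r by auto
  have above: "f0 xc < f0 z" if "z \<in> feasible_set f" "norm (z - xc) \<le> R" "z \<noteq> xc" for z
    using N(3)[of z] R0(2) that unfolding R_def by (auto simp: dist_norm norm_minus_commute)
  have cont: "continuous_on S f0" for S unfolding f0_inner by (intro continuous_intros)
  define C where "C = feasible_set f \<inter> {z. R / 2 \<le> norm (z - xc)} \<inter> cball xc R"
  have "closed (feasible_set f)"
  proof -
    have "feasible_set f = (\<Inter>i. {x. f i x \<le> 0})" unfolding feasible_set_def by auto
    then show ?thesis
      by (auto intro!: closed_INT closed_Collect_le cont_diff_continuous[OF f_C1] continuous_intros)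
  qed
  then have "compact C" unfolding C_def
    by (intro closed_Int_compact closed_Int closed_Collect_le continuous_intros compact_cball)
  have "\<exists>\<epsilon>>0. \<forall>z\<in>C. f0 xc + \<epsilon> \<le> f0 z"
  proof (cases "C = {}")
    case True
    then show ?thesis by (intro exI[of _ 1]) simp
  next
    case False
    from continuous_attains_inf[OF \<open>compact C\<close> False cont]
    obtain z where z: "z \<in> C" "\<forall>z'\<in>C. f0 z \<le> f0 z'" by auto
    have "f0 xc < f0 z" using z(1) R(1) unfolding C_def
      by (intro above) (auto simp: dist_norm norm_minus_commute)
    with z(2) show ?thesis by (intro exI[of _ "f0 z - f0 xc"]) simp
  qed
  then obtain \<epsilon>0 where \<epsilon>0: "0 < \<epsilon>0" "\<And>z. z \<in> C \<Longrightarrow> f0 xc + \<epsilon>0 \<le> f0 z" by blast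
  \<comment> \<open>The first entry bars the annulus, the second is the excess allowed by
    \<open>szo_step_trapped\<close>.\<close>
  define \<epsilon> where "\<epsilon> = min \<epsilon>0 (\<mu> * (R / 2)\<^sup>2)"
  have \<epsilon>: "0 < \<epsilon>" unfolding \<epsilon>_def using \<epsilon>0 \<mu>_pos R by simp
  define U where "U = ball xc (R / 2) \<inter> {z. f0 z < f0 xc + \<epsilon>}"
  have "open U" unfolding U_def
    by (intro open_Int open_ball open_Collect_less cont continuous_intros)
  moreover have "xc \<in> U" unfolding U_def using R \<epsilon> by simp
  ultimately obtain K where K: "K0 \<le> K" "\<forall>\<^sub>F \<eta> in at_right 0. X \<eta> K \<in> U"
    using acc unfolding accumulation_point_def by metis
  then obtain \<eta>1 where \<eta>1: "0 < \<eta>1" "\<And>\<eta>. 0 < \<eta> \<Longrightarrow> \<eta> < \<eta>1 \<Longrightarrow> X \<eta> K \<in> U"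
    unfolding eventually_at_right_field by auto
  have "X \<eta> k \<in> U" if \<eta>: "0 < \<eta>" "\<eta> < \<eta>1" and "K \<le> k" for \<eta> k
    using \<open>K \<le> k\<close>
  proof (induction k rule: dec_induct)
    case base
    show ?case by (rule \<eta>1(2)[OF \<eta>])
  next
    case (step k)
    let ?x = "X \<eta> k" and ?y = "X \<eta> (Suc k)"
    note st = iterate_step[OF \<eta>(1), of k]
    have x: "norm (?x - xc) < R / 2" "f0 ?x < f0 xc + \<epsilon>"
      using step.IH unfolding U_def by (auto simp: dist_norm norm_minus_commute)
    have "norm (?y - ?x) < R / 2"
    proof (rule szo_step_trapped[OF st R(1)])
      show "f0 xc \<le> f0 z" if "z \<in> feasible_set f" "norm (z - xc) \<le> R" for z
        using above[OF that] by (cases "z = xc") auto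
    qed (use x in \<open>auto simp: \<epsilon>_def\<close>)
    then have yR: "norm (?y - xc) < R" using norm_triangle_ineq[of "?y - ?x" "?x - xc"] x(1) by simp
    have "0 \<le> \<mu> * (norm (?y - ?x))\<^sup>2" using \<mu>_pos by simp
    then have fy: "f0 ?y < f0 xc + \<epsilon>" using szo_step_decrease[OF st] x(2) by linarith
    have "?y \<notin> C" using \<epsilon>0(2)[of ?y] fy unfolding \<epsilon>_def by auto
    then have "norm (?y - xc) < R / 2"
      using yR strict_feasible[OF szo_stepD(3)[OF st]] unfolding C_def
      by (auto simp: dist_norm norm_minus_commute)
    with fy show ?case unfolding U_def by (simp add: dist_norm norm_minus_commute)
  qed
  then have "norm (X \<eta> k - xc) < r" if "0 < \<eta>" "\<eta> < \<eta>1" "K \<le> k" for \<eta> k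
    using that R unfolding U_def by (fastforce simp: dist_norm norm_minus_commute)
  with \<eta>1(1) K(1) show ?thesis using that by blast
qed

lemma accumulation_point_feasible:
  assumes acc: "accumulation_point X xc"
  shows "xc \<in> feasible_set f"
proof -
  have "f i xc \<le> 0" for i
  proof (rule ccontr)
    assume "\<not> f i xc \<le> 0"
    moreover have "open {x. 0 < f i x}"
      by (intro open_Collect_less cont_diff_continuous[OF f_C1] continuous_intros)
    ultimately obtain k where "\<forall>\<^sub>F \<eta> in at_right 0. X \<eta> k \<in> {x. 0 < f i x}"
      using acc unfolding accumulation_point_def by (metis mem_Collect_eq not_le)
    moreover have "\<forall>\<^sub>F \<eta>::real in at_right 0. 0 < \<eta>" by (rule eventually_at_right_less)
    ultimately have "\<forall>\<^sub>F \<eta>::real in at_right 0. False"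
    proof eventually_elim
      case (elim \<eta>)
      then show ?case using iterate_strict[of \<eta> k] unfolding strict_def by (metis mem_Collect_eq less_asym)
    qed
    then show False by simp
  qed
  then show ?thesis unfolding feasible_set_def by simp
qed

text \<open>For \<open>f0 = 0\<close>, a strict local minimizer would be isolated in the feasible set, hence equal to some
  iterate; but iterates are interior points.\<close>

lemma objective_nonzero:
  assumes acc: "accumulation_point X xc" and min: "strict_local_minimizer f0 (feasible_set f) xc"
  shows "g \<noteq> 0"
proof
  assume g: "g = 0"
  obtain N where N: "open N" "xc \<in> N" "\<And>z. z \<in> N \<Longrightarrow> z \<in> feasible_set f \<Longrightarrow> z \<noteq> xc \<Longrightarrow> f0 xc < f0 z"
    using min unfolding strict_local_minimizer_def by blast
  have only: "z = xc" if "z \<in> N" "z \<in> feasible_set f" for z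
    using N(3)[OF that] unfolding f0_inner g by auto
  obtain k where "\<forall>\<^sub>F \<eta> in at_right 0. X \<eta> k \<in> N"
    using acc N unfolding accumulation_point_def by metis
  moreover have "\<forall>\<^sub>F \<eta>::real in at_right 0. 0 < \<eta>" by (rule eventually_at_right_less)
  ultimately have "\<forall>\<^sub>F \<eta> in at_right 0. X \<eta> k \<in> N \<and> 0 < \<eta>" by eventually_elim simp
  then obtain \<eta> where \<eta>: "X \<eta> k \<in> N" "0 < \<eta>"
    using eventually_happens trivial_limit_at_right_real by blast
  then have "X \<eta> k = xc" using only strict_feasible[OF iterate_strict] by blast
  then have xc: "strict xc" using iterate_strict[OF \<eta>(2), of k] by simp
  have "open {x. strict x}"
  proof -
    have "{x. strict x} = (\<Inter>i. {x. f i x < 0})" unfolding strict_def by auto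
    then show ?thesis
      by (auto intro!: open_INT open_Collect_less cont_diff_continuous[OF f_C1] continuous_intros)
  qed
  then have "open (N \<inter> {x. strict x})" using N(1) by blast
  moreover have "N \<inter> {x. strict x} = {xc}" using only strict_feasible xc N(2) by blast
  ultimately show False using not_open_singleton by metis
qed

lemma grad_f0:
  assumes "cont_diff f0"
  shows "grad f0 x = g"
proof -
  have "linear f0" unfolding f0_inner[abs_def] by (rule bounded_linear.linear[OF bounded_linear_inner_right])
  from grad_linear[OF this assms] have "g \<bullet> y = y \<bullet> grad f0 x" for y unfolding f0_inner .
  then show ?thesis by (metis inner_commute vector_eq_ldot)
qed

text \<open>Close to \<open>xc\<close> the subproblem satisfies a perturbed version of the optimality system at \<open>xc\<close>: the
  constraints that are inactive at \<open>xc\<close> have inactive models, and all gradients are almost those at \<open>xc\<close>.\<close>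

lemma multipliers_near_minimizer:
  assumes f0: "cont_diff f0" and acc: "accumulation_point X xc"
    and min: "strict_local_minimizer f0 (feasible_set f) xc"
    and licq: "licq f xc" and lc: "kkt_pair 0 f0 f xc lc" "infnorm lc \<le> \<Lambda>"
  obtains K \<eta>1 where "0 < \<eta>1" "1 \<le> K"
    "\<And>\<eta> k. 0 < \<eta> \<Longrightarrow> \<eta> < \<eta>1 \<Longrightarrow> K \<le> k \<Longrightarrow>
      \<exists>l \<in> multipliers f0 f M \<mu> \<eta> (radius \<eta> k) (X \<eta> k) (X \<eta> (Suc k)). infnorm l \<le> 2 * \<Lambda>"
proof -
  let ?d = "sqrt (real CARD('n))"
  have xc: "xc \<in> feasible_set f" using lc(1) unfolding kkt_pair_0_iff by blast
  have lc0: "\<And>i. lc $ i * f i xc = 0" "g + (\<Sum>i\<in>UNIV. (lc $ i) *\<^sub>R grad (f i) xc) = 0"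
    using lc(1) unfolding kkt_pair_0_iff grad_f0[OF f0] by auto
  obtain r where r: "0 < r" "\<And>b a l. norm (b - g) \<le> r \<Longrightarrow> (\<And>i. norm (a i - grad (f i) xc) \<le> r) \<Longrightarrow>
    (\<And>i. l $ i * f i xc = 0) \<Longrightarrow> b + (\<Sum>i\<in>UNIV. (l $ i) *\<^sub>R a i) = 0 \<Longrightarrow> norm (l - lc) \<le> \<Lambda>"
    by (rule licq_multiplier_bound[OF licq \<Lambda>_pos lc0]) blast
  \<comment> \<open>With iterates within \<open>\<rho>\<close> of \<open>xc\<close>, steps at most
    \<open>2 * \<rho>\<close> and radii at most \<open>\<rho>\<close>, three bounds are needed. The
    first makes inactive models negative, the second keeps constraint gradients within
    \<open>r\<close>, and the third does so for the objective gradient. In the first,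
    \<open>8 * M i\<close> uses \<open>\<rho> < 1\<close> to linearize the square.\<close>
  have "\<forall>\<^sub>F \<rho> in at_right 0. \<forall>i. f i xc < 0 \<longrightarrow> (L i + 2 * ?d * L i + 8 * M i) * \<rho> < - f i xc"
  proof (rule eventually_all_finite)
    fix i
    show "\<forall>\<^sub>F \<rho> in at_right 0. f i xc < 0 \<longrightarrow> (L i + 2 * ?d * L i + 8 * M i) * \<rho> < - f i xc"
      by (cases "f i xc < 0") (auto intro: eventually_small_multiple)
  qed
  moreover have "\<forall>\<^sub>F \<rho> in at_right 0. \<forall>i. (?d * M i / 2 + 9 * M i) * \<rho> < r"
    using r(1) by (intro eventually_all_finite eventually_small_multiple)
  moreover have "\<forall>\<^sub>F \<rho> in at_right 0. 4 * \<mu> * \<rho> < r" using r(1) by (rule eventually_small_multiple)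
  moreover have "\<forall>\<^sub>F \<rho>::real in at_right 0. \<rho> \<in> {0<..<1}" by (rule eventually_at_right_real) simp
  ultimately have "\<forall>\<^sub>F \<rho> in at_right 0. (\<forall>i. f i xc < 0 \<longrightarrow> (L i + 2 * ?d * L i + 8 * M i) * \<rho> < - f i xc)
      \<and> (\<forall>i. (?d * M i / 2 + 9 * M i) * \<rho> < r) \<and> 4 * \<mu> * \<rho> < r \<and> 0 < \<rho> \<and> \<rho> < 1"
    by eventually_elim auto
  then obtain \<rho> where \<rho>: "\<And>i. f i xc < 0 \<Longrightarrow> (L i + 2 * ?d * L i + 8 * M i) * \<rho> < - f i xc"
    "\<And>i. (?d * M i / 2 + 9 * M i) * \<rho> < r" "4 * \<mu> * \<rho> < r" "0 < \<rho>" "\<rho> < 1"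
    using eventually_happens trivial_limit_at_right_real by blast
  \<comment> \<open>From this index on, the entry \<open>1 / k\<close> forces the sampling radius
    below \<open>\<rho>\<close>.\<close>
  define K0 where "K0 = nat \<lceil>1 / \<rho>\<rceil> + 1"
  have K0: "1 \<le> K0" "1 / \<rho> \<le> real K0" unfolding K0_def by (auto intro: order_trans[OF real_nat_ceiling_ge])
  obtain K \<eta>1 where K: "0 < \<eta>1" "K0 \<le> K"
    "\<And>\<eta> k. 0 < \<eta> \<Longrightarrow> \<eta> < \<eta>1 \<Longrightarrow> K \<le> k \<Longrightarrow> norm (X \<eta> k - xc) < \<rho>"
    by (rule eventually_trapped[OF acc min \<rho>(4), of K0]) blast
  show ?thesis
  proof (rule that[OF K(1)])
    show "1 \<le> K" using K0 K(2) by simp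
    fix \<eta> k
    assume \<eta>: "0 < \<eta>" "\<eta> < \<eta>1" and k: "K \<le> k"
    let ?x = "X \<eta> k" and ?y = "X \<eta> (Suc k)" and ?\<nu> = "radius \<eta> k"
    note st = iterate_step[OF \<eta>(1), of k]
    note adm = szo_stepD(1)[OF st]
    have xx: "norm (?x - xc) \<le> \<rho>" "norm (?y - xc) \<le> \<rho>"
      using K(3)[OF \<eta>, of k] K(3)[OF \<eta>, of "Suc k"] k by auto
    have yx: "norm (?y - ?x) \<le> 2 * \<rho>"
      using norm_triangle_ineq4[of "?y - xc" "?x - xc"] xx by simp
    have k0: "1 / \<rho> \<le> real k" "k \<noteq> 0" using K0 K(2) k by auto
    have "?\<nu> \<le> 1 / real k" by (rule sampling_radius_le(3)[OF k0(2)])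
    also have "\<dots> \<le> \<rho>" using k0 \<rho>(4) by (simp add: field_simps)
    finally have \<nu>: "?\<nu> \<le> \<rho>" .
    have xf: "?x \<in> feasible_set f" using strict_feasible szo_stepD(2)[OF st] by blast
    obtain l :: "real ^ 'm" where l: "\<And>i. 0 \<le> l $ i" "\<And>i. l $ i * quad_model ?\<nu> (f i) (M i) ?x ?y = 0"
      "(g + (2 * \<mu>) *\<^sub>R (?y - ?x)) +
        (\<Sum>i\<in>UNIV. (l $ i) *\<^sub>R (fd_grad ?\<nu> (f i) ?x + (4 * M i) *\<^sub>R (?y - ?x))) = 0"
      by (rule szo_step_multipliers[OF st]) blast
    have "norm (l - lc) \<le> \<Lambda>"
    proof (rule r(2)[OF _ _ _ l(3)])
      have "norm ((g + (2 * \<mu>) *\<^sub>R (?y - ?x)) - g) = 2 * \<mu> * norm (?y - ?x)" using \<mu>_pos by simp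
      also have "\<dots> \<le> 2 * \<mu> * (2 * \<rho>)" using yx \<mu>_pos by (intro mult_left_mono) auto
      finally show "norm ((g + (2 * \<mu>) *\<^sub>R (?y - ?x)) - g) \<le> r" using \<rho>(3) by simp
    next
      fix i
      let ?e1 = "fd_grad ?\<nu> (f i) ?x - grad (f i) ?x" and ?e2 = "grad (f i) ?x - grad (f i) xc"
        and ?e3 = "(4 * M i) *\<^sub>R (?y - ?x)"
      have "norm ?e1 \<le> ?d * M i / 2 * \<rho>"
        using M_pos[of i] by (intro order_trans[OF fd_error[OF adm] mult_left_mono[OF \<nu>]]) simp
      moreover have "norm ?e2 \<le> M i * \<rho>"
        using lipschitz_onD[OF grad_lip[of i] xf xc] mult_left_mono[OF xx(1) less_imp_le[OF M_pos[of i]]]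
        unfolding dist_norm by (rule order_trans)
      moreover have "norm ?e3 \<le> 8 * M i * \<rho>"
        using mult_left_mono[OF yx, of "4 * M i"] M_pos[of i] by simp
      moreover have "norm (fd_grad ?\<nu> (f i) ?x + ?e3 - grad (f i) xc) \<le> norm ?e1 + norm ?e2 + norm ?e3"
        using norm_triangle_ineq[of "?e1 + ?e2" ?e3] norm_triangle_ineq[of ?e1 ?e2]
        by (simp add: algebra_simps)
      moreover have "?d * M i / 2 * \<rho> + M i * \<rho> + 8 * M i * \<rho> < r"
        using \<rho>(2)[of i] by (simp add: algebra_simps)
      ultimately show "norm (fd_grad ?\<nu> (f i) ?x + ?e3 - grad (f i) xc) \<le> r" by linarith
    next
      fix i
      show "l $ i * f i xc = 0"
      proof (cases "f i xc = 0")
        case False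
        then have neg: "f i xc < 0" using xc unfolding feasible_set_def by (simp add: order_less_le)
        have "f i ?x \<le> f i xc + L i * \<rho>"
          using lipschitz_onD[OF f_lip[of i] xf xc] mult_left_mono[OF xx(1) less_imp_le[OF L_pos[of i]]]
          unfolding dist_norm real_norm_def abs_le_iff by linarith
        moreover have "fd_grad ?\<nu> (f i) ?x \<bullet> (?y - ?x) \<le> ?d * L i * (2 * \<rho>)"
          using norm_cauchy_schwarz[of "fd_grad ?\<nu> (f i) ?x" "?y - ?x"]
            mult_mono[OF fd_grad_bound[OF adm, of i] yx] L_pos[of i] by simp
        moreover have "2 * M i * (norm (?y - ?x))\<^sup>2 \<le> 2 * M i * (4 * \<rho>)"
        proof (rule mult_left_mono)
          have "(norm (?y - ?x))\<^sup>2 \<le> (2 * \<rho>)\<^sup>2" using yx by (intro power_mono) auto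
          also have "\<dots> \<le> 4 * \<rho>" using \<rho>(4,5) by (simp add: power2_eq_square)
          finally show "(norm (?y - ?x))\<^sup>2 \<le> 4 * \<rho>" .
        qed (use M_pos[of i] in simp)
        moreover have "L i * \<rho> + ?d * L i * (2 * \<rho>) + 2 * M i * (4 * \<rho>) < - f i xc"
          using \<rho>(1)[OF neg] by (simp add: algebra_simps)
        ultimately have "quad_model ?\<nu> (f i) (M i) ?x ?y < 0" unfolding quad_model_def by linarith
        then show ?thesis using l(2)[of i] by simp
      qed simp
    qed
    then have "infnorm l \<le> 2 * \<Lambda>"
      unfolding infnorm_le_iff using component_le_norm_cart[of "l - lc"] lc(2)[unfolded infnorm_le_iff]
      by (smt (verit) vector_minus_component)
    \<comment> \<open>The exact multipliers of the subproblem have zero residuals, so they pass the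
      test for every positive accuracy.\<close>
    moreover have "l \<in> multipliers f0 f M \<mu> \<eta> ?\<nu> ?x ?y"
      using l(1) \<eta>(1) unfolding multipliers_iff delta1_def delta2_def grad_f0[OF f0] l(2,3) by simp
    ultimately show "\<exists>l\<in>multipliers f0 f M \<mu> \<eta> ?\<nu> ?x ?y. infnorm l \<le> 2 * \<Lambda>" by blast
  qed
qed

section \<open>The tolerance, approximate KKT pairs and termination\<close>

lemma h_tol_pos:
  assumes "0 < \<eta>"
  shows "0 < h_tol d L M \<mu> \<Lambda> \<eta>"
proof -
  have "0 < (\<Sum>i\<in>UNIV. M i)" using M_pos by (intro sum_pos) auto
  moreover have "0 < alpha_max d M + 2 * Lmax + 2 * Mmax"
    unfolding alpha_max_eq Mmax_def[symmetric] using Lmax_pos Mmax_pos by (intro add_nonneg_pos add_pos_pos) auto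
  ultimately show ?thesis
    unfolding h_tol_def Lmax_def[symmetric] Mmax_def[symmetric] using assms \<Lambda>_pos \<mu>_pos by simp
qed

lemma h_tol_le:
  "h_tol d L M \<mu> \<Lambda> \<eta> \<le> \<eta> / (60 * \<Lambda> * (\<Sum>i\<in>UNIV. M i))"
  "h_tol d L M \<mu> \<Lambda> \<eta> \<le> \<eta> / (12 * \<mu>)" "h_tol d L M \<mu> \<Lambda> \<eta> \<le> 1"
  "h_tol d L M \<mu> \<Lambda> \<eta> \<le> \<eta> / (4 * \<Lambda> * (alpha_max d M + 2 * Lmax + 2 * Mmax))"
  unfolding h_tol_def Lmax_def Mmax_def by (intro Min_le; simp)+

text \<open>The test controls residuals of the models. The bound \<open>2 * \<Lambda>\<close> on the
  multiplier limits how far they can differ from the true residuals, and the entries of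
  \<open>h_tol\<close> and of the sampling radius are sized for that difference.\<close>

lemma accepted_kkt_pair:
  assumes f0: "cont_diff f0" and \<eta>: "0 < \<eta>" and k: "1 \<le> k"
    and short: "norm (X \<eta> (Suc k) - X \<eta> k) \<le> h_tol CARD('n) L M \<mu> \<Lambda> \<eta>"
    and l: "l \<in> multipliers f0 f M \<mu> \<eta> (radius \<eta> k) (X \<eta> k) (X \<eta> (Suc k))" "infnorm l \<le> 2 * \<Lambda>"
  shows "kkt_pair \<eta> f0 f (X \<eta> (Suc k)) l"
proof -
  define x where "x = X \<eta> k"
  define y where "y = X \<eta> (Suc k)"
  define \<nu> where "\<nu> = radius \<eta> k"
  define h where "h = h_tol CARD('n) L M \<mu> \<Lambda> \<eta>"
  define n where "n = norm (y - x)"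
  define \<alpha> where "\<alpha> = alpha_max CARD('n) M"
  have st: "szo_step \<nu> x y" unfolding \<nu>_def x_def y_def by (rule iterate_step[OF \<eta>])
  note adm = szo_stepD(1)[OF st] and seg = szo_stepD(4)[OF st]
  have fx: "x \<in> feasible_set f" "y \<in> feasible_set f" using strict_feasible szo_stepD(2,3)[OF st] by auto
  have n: "0 \<le> n" "n \<le> h" using short unfolding n_def x_def y_def h_def by auto
  have h: "0 < h" "h \<le> 1" unfolding h_def using h_tol_pos[OF \<eta>] h_tol_le(3) by auto
  have \<alpha>: "0 < \<alpha>" unfolding \<alpha>_def by (rule alpha_max_pos)
  have \<alpha>i: "sqrt (real CARD('n)) * M i / 2 \<le> \<alpha>" for i
    unfolding \<alpha>_def alpha_max_eq Mmax_def[symmetric]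
    using M_le_Mmax[of i] by (intro divide_right_mono mult_left_mono) auto
  have \<nu>0: "0 < \<nu>" by (rule admissibleD(2)[OF adm])
  \<comment> \<open>This is where index 0 must be excluded: the entry \<open>1 / k\<close> is absent
    there.\<close>
  have "1 / real k \<le> 1" using k by simp
  then have \<nu>1: "\<nu> \<le> 1" using sampling_radius_le(3)[of k \<eta> x] k unfolding \<nu>_def x_def by linarith
  have fd: "norm (fd_grad \<nu> (f i) x - grad (f i) x) \<le> \<alpha> * \<nu>" for i
    using fd_error[OF adm, of i] mult_right_mono[OF \<alpha>i, of \<nu> i] \<nu>0 by linarith
  have l0: "0 \<le> l $ i" "l $ i \<le> 2 * \<Lambda>" for i
    using l unfolding multipliers_iff infnorm_le_iff by (auto simp: abs_le_iff)
  have d1: "delta1 f0 f M \<mu> \<nu> x y l \<le> \<eta> / 2" and d2: "delta2 f M \<nu> x y l i \<le> \<eta> / 2" for i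
    using l(1) unfolding multipliers_iff x_def y_def \<nu>_def by auto
  define V where "V = grad f0 y + (2 * \<mu>) *\<^sub>R (y - x) +
    (\<Sum>i\<in>UNIV. (l $ i) *\<^sub>R (fd_grad \<nu> (f i) x + (4 * M i) *\<^sub>R (y - x)))"
  \<comment> \<open>The gap between model gradient and true gradient at \<open>y\<close>. Besides
    the finite-difference error it costs \<open>M i * h\<close> for moving the gradient and
    \<open>4 * M i * h\<close> for the model curvature.\<close>
  define E where "E i = fd_grad \<nu> (f i) x - grad (f i) y + (4 * M i) *\<^sub>R (y - x)" for i
  have E: "norm (E i) \<le> \<alpha> * \<nu> + 5 * M i * h" for i
  proof -
    have "E i = (fd_grad \<nu> (f i) x - grad (f i) x) + (grad (f i) x - grad (f i) y) + (4 * M i) *\<^sub>R (y - x)"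
      unfolding E_def by simp
    then have "norm (E i) \<le> norm (fd_grad \<nu> (f i) x - grad (f i) x) + norm (grad (f i) x - grad (f i) y)
        + norm ((4 * M i) *\<^sub>R (y - x))"
      using norm_triangle_ineq[of "(fd_grad \<nu> (f i) x - grad (f i) x) + (grad (f i) x - grad (f i) y)"]
        norm_triangle_ineq[of "fd_grad \<nu> (f i) x - grad (f i) x" "grad (f i) x - grad (f i) y"]
      by (smt (verit))
    moreover have "norm (grad (f i) x - grad (f i) y) \<le> M i * h"
      using lipschitz_onD[OF grad_lip[of i] fx] mult_left_mono[OF n(2) less_imp_le[OF M_pos[of i]]]
      unfolding n_def dist_norm norm_minus_commute[of x y] by (rule order_trans)
    moreover have "norm ((4 * M i) *\<^sub>R (y - x)) \<le> 4 * M i * h"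
      using mult_left_mono[OF n(2), of "4 * M i"] M_pos[of i] unfolding n_def by simp
    ultimately show ?thesis using fd[of i] by (simp add: algebra_simps)
  qed
  have "grad f0 y + (\<Sum>i\<in>UNIV. (l $ i) *\<^sub>R grad (f i) y)
      = V - (2 * \<mu>) *\<^sub>R (y - x) - (\<Sum>i\<in>UNIV. (l $ i) *\<^sub>R E i)"
    unfolding V_def E_def by (simp add: sum_subtractf sum.distrib algebra_simps)
  also have "norm \<dots> \<le> norm V + norm ((2 * \<mu>) *\<^sub>R (y - x)) + (\<Sum>i\<in>UNIV. norm ((l $ i) *\<^sub>R E i))"
    by (intro order_trans[OF norm_triangle_ineq4] add_mono norm_triangle_ineq4 norm_sum)
  also have "\<dots> \<le> \<eta> / 2 + 2 * \<mu> * h + (\<Sum>i\<in>(UNIV :: 'm set). 2 * \<Lambda> * (\<alpha> * \<nu> + 5 * M i * h))"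
  proof (intro add_mono sum_mono)
    show "norm V \<le> \<eta> / 2" using d1 unfolding delta1_def V_def .
    show "norm ((2 * \<mu>) *\<^sub>R (y - x)) \<le> 2 * \<mu> * h"
      using mult_left_mono[OF n(2), of "2 * \<mu>"] \<mu>_pos unfolding n_def by simp
    show "norm ((l $ i) *\<^sub>R E i) \<le> 2 * \<Lambda> * (\<alpha> * \<nu> + 5 * M i * h)" for i
      using mult_mono[OF l0(2) E, of i i] l0(1)[of i] \<Lambda>_pos by simp
  qed
  also have "\<dots> = \<eta> / 2 + 2 * \<mu> * h + 2 * \<Lambda> * real CARD('m) * \<alpha> * \<nu> + 10 * \<Lambda> * (\<Sum>i\<in>UNIV. M i) * h"
    by (simp add: distrib_left sum.distrib sum_distrib_left sum_distrib_right mult_ac)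
  also have "\<dots> \<le> \<eta>"
  proof -
    have S: "0 < (\<Sum>i\<in>UNIV. M i)" using M_pos by (intro sum_pos) auto
    have "2 * \<mu> * h \<le> \<eta> / 6"
      using h_tol_le(2)[of "CARD('n)" \<eta>] \<mu>_pos unfolding h_def[symmetric] by (simp add: field_simps)
    moreover have "2 * \<Lambda> * real CARD('m) * \<alpha> * \<nu> \<le> \<eta> / 6"
      using sampling_radius_le(2)[of \<eta> k x] \<alpha> \<Lambda>_pos unfolding \<nu>_def[folded x_def, symmetric] \<alpha>_def[symmetric]
      by (simp add: field_simps)
    moreover have "10 * \<Lambda> * (\<Sum>i\<in>UNIV. M i) * h \<le> \<eta> / 6"
      using h_tol_le(1)[of "CARD('n)" \<eta>] \<Lambda>_pos S unfolding h_def[symmetric] by (simp add: field_simps)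
    ultimately show ?thesis by simp
  qed
  finally have stat: "norm (grad f0 y + (\<Sum>i\<in>UNIV. (l $ i) *\<^sub>R grad (f i) y)) \<le> \<eta>" .
  have comp: "\<bar>l $ i * f i y\<bar> \<le> \<eta>" for i
  proof -
    let ?q = "quad_model \<nu> (f i) (M i) x y"
    have D: "0 < \<alpha> + 2 * Lmax + 2 * Mmax" using \<alpha> Lmax_pos Mmax_pos by simp
    have "\<bar>f i y - f i x\<bar> \<le> L i * n"
      using lipschitz_onD[OF f_lip[of i] fx(2,1)] unfolding n_def by (simp add: dist_norm)
    moreover have "L i * n \<le> Lmax * n" using L_le_Lmax n(1) by (rule mult_right_mono)
    moreover have "\<bar>grad (f i) x \<bullet> (y - x)\<bar> \<le> L i * n"
      using directional_derivative_bound[OF f_C1 seg f_lip] unfolding n_def .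
    moreover have "\<bar>fd_grad \<nu> (f i) x \<bullet> (y - x) - grad (f i) x \<bullet> (y - x)\<bar> \<le> \<alpha> * n"
    proof -
      have "\<bar>(fd_grad \<nu> (f i) x - grad (f i) x) \<bullet> (y - x)\<bar> \<le> norm (fd_grad \<nu> (f i) x - grad (f i) x) * n"
        unfolding n_def by (rule Cauchy_Schwarz_ineq2)
      also have "\<dots> \<le> \<alpha> * 1 * n"
        using \<alpha> n(1) by (intro mult_right_mono order_trans[OF fd mult_left_mono[OF \<nu>1]]) auto
      finally show ?thesis by (simp add: inner_diff_left)
    qed
    moreover have "2 * M i * n\<^sup>2 \<le> 2 * Mmax * n"
      using n h(2) M_le_Mmax[of i] M_pos[of i] Mmax_pos
      by (intro mult_mono) (auto simp: power2_eq_square mult_left_le)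
    moreover have "0 \<le> 2 * M i * n\<^sup>2" using M_pos[of i] by simp
    \<comment> \<open>One \<open>Lmax\<close> pays for the change of \<open>f i\<close>, the other
      for the directional derivative; \<open>\<alpha>\<close> is the finite-difference error for
      radius at most 1.\<close>
    ultimately have "\<bar>f i y - ?q\<bar> \<le> (\<alpha> + 2 * Lmax + 2 * Mmax) * n"
      unfolding quad_model_def n_def[symmetric] distrib_right abs_le_iff by linarith
    also have "\<dots> \<le> (\<alpha> + 2 * Lmax + 2 * Mmax) * h" using n(2) D by (intro mult_left_mono) auto
    finally have "\<bar>l $ i\<bar> * \<bar>f i y - ?q\<bar> \<le> 2 * \<Lambda> * ((\<alpha> + 2 * Lmax + 2 * Mmax) * h)"
      using l0[of i] by (intro mult_mono) auto
    also have "\<dots> \<le> \<eta> / 2"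
    proof -
      have "0 < 4 * \<Lambda> * (\<alpha> + 2 * Lmax + 2 * Mmax)" using \<Lambda>_pos D by simp
      then have "h * (4 * \<Lambda> * (\<alpha> + 2 * Lmax + 2 * Mmax)) \<le> \<eta>"
        using h_tol_le(4)[of "CARD('n)" \<eta>] unfolding h_def[symmetric] \<alpha>_def[symmetric]
        by (simp only: pos_le_divide_eq)
      then show ?thesis by (simp add: mult_ac)
    qed
    finally have "\<bar>l $ i * f i y - l $ i * ?q\<bar> \<le> \<eta> / 2" by (simp add: abs_mult right_diff_distrib[symmetric])
    then show ?thesis using d2[of i] unfolding delta2_def by linarith
  qed
  show ?thesis
    using stat comp l0(1) fx(2) unfolding kkt_pair_def y_def by blast
qed

lemma accepts_iff:
  "szo_accepts f0 f L M \<mu> \<Lambda> x0 \<eta> \<xi> k l \<longleftrightarrow>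
    norm (X \<eta> (Suc k) - X \<eta> k) \<le> \<xi> \<and>
    is_arg_min infnorm (\<lambda>l. l \<in> multipliers f0 f M \<mu> \<eta> (radius \<eta> k) (X \<eta> k) (X \<eta> (Suc k))) l \<and>
    infnorm l \<le> 2 * \<Lambda>"
  unfolding szo_accepts_def Let_def ..

theorem termination_and_correctness:
  assumes f0: "cont_diff f0" and acc: "accumulation_point X xc"
    and min: "strict_local_minimizer f0 (feasible_set f) xc"
    and licq: "licq f xc" and lc: "infnorm (THE l. kkt_pair 0 f0 f xc l) < \<Lambda>"
    and bdd: "bdd_below (f0 ` feasible_set f)"
  obtains \<eta>1 where "0 < \<eta>1"
    "\<And>\<eta>. 0 < \<eta> \<Longrightarrow> \<eta> < \<eta>1 \<Longrightarrow> \<exists>xt lt kt.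
      szo_returns f0 f L M \<mu> \<Lambda> x0 \<eta> (h_tol CARD('n) L M \<mu> \<Lambda> \<eta>) xt lt kt \<and>
      real kt \<le> iter_bound CARD('n) L M \<mu> \<Lambda> (f0 x0 - (INF x\<in>feasible_set f. f0 x)) \<eta> + 1"
    "\<And>\<eta> xt lt kt. 0 < \<eta> \<Longrightarrow> \<eta> < \<eta>1 \<Longrightarrow>
      szo_returns f0 f L M \<mu> \<Lambda> x0 \<eta> (h_tol CARD('n) L M \<mu> \<Lambda> \<eta>) xt lt kt \<Longrightarrow> kkt_pair \<eta> f0 f xt lt"
proof -
  note xc = accumulation_point_feasible[OF acc]
  obtain lc where kkt: "kkt_pair 0 f0 f xc lc"
    by (rule kkt_pair_exists[OF f0 f_C1 xc licq min])
  then have "(THE l. kkt_pair 0 f0 f xc l) = lc" using kkt_pair_unique[OF licq] by blast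
  with lc have lc: "infnorm lc \<le> \<Lambda>" by simp
  obtain K \<eta>0 where K: "0 < \<eta>0" "1 \<le> K"
    "\<And>\<eta> k. 0 < \<eta> \<Longrightarrow> \<eta> < \<eta>0 \<Longrightarrow> K \<le> k \<Longrightarrow>
      \<exists>l \<in> multipliers f0 f M \<mu> \<eta> (radius \<eta> k) (X \<eta> k) (X \<eta> (Suc k)). infnorm l \<le> 2 * \<Lambda>"
    by (rule multipliers_near_minimizer[OF f0 acc min licq kkt lc]) blast
  obtain s where s: "0 < s" "\<And>k \<eta>. k < K \<Longrightarrow> 0 < \<eta> \<Longrightarrow> s \<le> norm (X \<eta> (Suc k) - X \<eta> k)"
    using early_steps_long[OF objective_nonzero[OF acc min], of K] by blast
  \<comment> \<open>Below \<open>12 * \<mu> * s\<close> the tolerance, at most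
    \<open>\<eta> / (12 * \<mu>)\<close>, is smaller than every early step.\<close>
  define \<eta>1 where "\<eta>1 = min \<eta>0 (12 * \<mu> * s)"
  define h where "h \<eta> = h_tol CARD('n) L M \<mu> \<Lambda> \<eta>" for \<eta>
  have "0 < \<eta>1" unfolding \<eta>1_def using K(1) s(1) \<mu>_pos by simp
  have late: "K \<le> k" if \<eta>: "0 < \<eta>" "\<eta> < \<eta>1" and "norm (X \<eta> (Suc k) - X \<eta> k) \<le> h \<eta>" for \<eta> k
  proof (rule ccontr)
    assume "\<not> K \<le> k"
    then have "s \<le> h \<eta>" using s(2)[of k \<eta>] that by simp
    also have "\<dots> \<le> \<eta> / (12 * \<mu>)" unfolding h_def by (rule h_tol_le(2))
    also have "\<dots> < s" using \<eta>(2) \<mu>_pos unfolding \<eta>1_def by (simp add: field_simps)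
    finally show False by simp
  qed
  show ?thesis
  proof (rule that[OF \<open>0 < \<eta>1\<close>])
    fix \<eta> assume \<eta>: "0 < \<eta>" "\<eta> < \<eta>1"
    have h: "0 < h \<eta>" unfolding h_def by (rule h_tol_pos[OF \<eta>(1)])
    obtain k where k: "norm (X \<eta> (Suc k) - X \<eta> k) \<le> h \<eta>"
      "real k \<le> (f0 x0 - (INF x\<in>feasible_set f. f0 x)) / (\<mu> * (h \<eta>)\<^sup>2)"
      by (rule short_step_exists[OF \<eta>(1) h bdd]) blast
    obtain l where "l \<in> multipliers f0 f M \<mu> \<eta> (radius \<eta> k) (X \<eta> k) (X \<eta> (Suc k))" "infnorm l \<le> 2 * \<Lambda>"
      using K(3)[OF \<eta>(1) _ late[OF \<eta> k(1)]] \<eta>(2) unfolding \<eta>1_def by auto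
    then obtain l' where "is_arg_min infnorm
        (\<lambda>l. l \<in> multipliers f0 f M \<mu> \<eta> (radius \<eta> k) (X \<eta> k) (X \<eta> (Suc k))) l'" "infnorm l' \<le> 2 * \<Lambda>"
      by (rule infnorm_arg_min_exists[OF closed_multipliers])
    then have "\<exists>l. szo_accepts f0 f L M \<mu> \<Lambda> x0 \<eta> (h \<eta>) k l" using k(1) unfolding accepts_iff by blast
    \<comment> \<open>Acceptance may occur before the short step found above, which only improves
      the bound.\<close>
    define k' where "k' = (LEAST k. \<exists>l. szo_accepts f0 f L M \<mu> \<Lambda> x0 \<eta> (h \<eta>) k l)"
    have "\<exists>l. szo_accepts f0 f L M \<mu> \<Lambda> x0 \<eta> (h \<eta>) k' l"
      unfolding k'_def by (rule LeastI) fact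
    then obtain lt where lt: "szo_accepts f0 f L M \<mu> \<Lambda> x0 \<eta> (h \<eta>) k' lt" ..
    have "k' \<le> k" unfolding k'_def by (rule Least_le) fact
    moreover have "\<forall>j<k'. \<nexists>l. szo_accepts f0 f L M \<mu> \<Lambda> x0 \<eta> (h \<eta>) j l"
      unfolding k'_def by (blast dest: not_less_Least)
    ultimately show "\<exists>xt lt kt.
      szo_returns f0 f L M \<mu> \<Lambda> x0 \<eta> (h_tol CARD('n) L M \<mu> \<Lambda> \<eta>) xt lt kt \<and>
      real kt \<le> iter_bound CARD('n) L M \<mu> \<Lambda> (f0 x0 - (INF x\<in>feasible_set f. f0 x)) \<eta> + 1"
      using lt k(2) unfolding szo_returns_def iter_bound_def h_def[symmetric]
      by (intro exI[of _ "X \<eta> (k' + 1)"] exI[of _ lt] exI[of _ "k' + 1"]) auto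
  next
    fix \<eta> xt lt kt
    assume \<eta>: "0 < \<eta>" "\<eta> < \<eta>1"
      and "szo_returns f0 f L M \<mu> \<Lambda> x0 \<eta> (h_tol CARD('n) L M \<mu> \<Lambda> \<eta>) xt lt kt"
    then obtain k where k: "xt = X \<eta> (Suc k)" "szo_accepts f0 f L M \<mu> \<Lambda> x0 \<eta> (h \<eta>) k lt"
      unfolding szo_returns_def h_def by auto
    have short: "norm (X \<eta> (Suc k) - X \<eta> k) \<le> h \<eta>" using k(2) unfolding accepts_iff by blast
    have "1 \<le> k" using late[OF \<eta> short] K(2) by simp
    then show "kkt_pair \<eta> f0 f xt lt"
      unfolding k(1) using k(2) short unfolding accepts_iff is_arg_min_def h_def
      by (intro accepted_kkt_pair[OF f0 \<eta>(1)]) auto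
  qed
qed

text \<open>Of all quantities in \<open>h_tol\<close> only \<open>alpha_max\<close> depends on the
  dimension, and it grows like sqrt(d). Squaring the tolerance therefore costs one factor
  \<open>d\<close> in the iteration bound.\<close>

lemma h_tol_lower_bound:
  obtains H where "0 < H" "\<And>d \<eta>. 1 \<le> d \<Longrightarrow> 0 < \<eta> \<Longrightarrow> \<eta> \<le> 1 \<Longrightarrow>
    \<eta> / (H * sqrt (real d)) \<le> h_tol d L M \<mu> \<Lambda> \<eta>"
proof -
  define S where "S = 60 * \<Lambda> * (\<Sum>i\<in>UNIV. M i)"
  define T where "T = 4 * \<Lambda> * (3 * Mmax + 2 * Lmax)"
  define H where "H = S + 12 * \<mu> + 1 + T"
  have S: "0 < S" unfolding S_def using M_pos \<Lambda>_pos by (simp add: sum_pos)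
  have T: "0 < T" unfolding T_def using \<Lambda>_pos Lmax_pos Mmax_pos by simp
  have H: "S \<le> H" "12 * \<mu> \<le> H" "1 \<le> H" "T \<le> H" unfolding H_def using S T \<mu>_pos by auto
  show ?thesis
  proof (rule that[of H])
    show "0 < H" using H(3) by simp
    fix d :: nat and \<eta> :: real
    assume d: "1 \<le> d" and \<eta>: "0 < \<eta>" "\<eta> \<le> 1"
    let ?r = "sqrt (real d)"
    have r: "1 \<le> ?r" using d by simp
    have le: "a \<le> H * ?r" if "a \<le> H" for a
      using that mult_left_mono[OF r, of H] H(3) by linarith
    have frac: "\<eta> / (H * ?r) \<le> \<eta> / a" if "0 < a" "a \<le> H * ?r" for a
      using that \<eta>(1) by (intro divide_left_mono) auto
    have "\<eta> / (H * ?r) \<le> 1" using frac[of 1] le[OF H(3)] \<eta> by simp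
    moreover have "0 < 4 * \<Lambda> * (alpha_max d M + 2 * Lmax + 2 * Mmax)"
      unfolding alpha_max_eq Mmax_def[symmetric] using Lmax_pos Mmax_pos \<Lambda>_pos
      by (intro mult_pos_pos add_nonneg_pos add_pos_pos) auto
    moreover have "4 * \<Lambda> * (alpha_max d M + 2 * Lmax + 2 * Mmax) \<le> T * ?r"
    proof -
      have "?r * Mmax / 2 \<le> ?r * Mmax" using r Mmax_pos by simp
      moreover have "2 * Lmax \<le> 2 * Lmax * ?r" "2 * Mmax \<le> 2 * Mmax * ?r" using r Lmax_pos Mmax_pos by auto
      ultimately have "alpha_max d M + 2 * Lmax + 2 * Mmax \<le> (3 * Mmax + 2 * Lmax) * ?r"
        unfolding alpha_max_eq Mmax_def[symmetric] by (simp add: algebra_simps)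
      from mult_left_mono[OF this, of "4 * \<Lambda>"] \<Lambda>_pos show ?thesis unfolding T_def by (simp add: mult_ac)
    qed
    moreover have "T * ?r \<le> H * ?r" using H(4) by (intro mult_right_mono) auto
    ultimately show "\<eta> / (H * ?r) \<le> h_tol d L M \<mu> \<Lambda> \<eta>"
      unfolding h_tol_def Lmax_def[symmetric] Mmax_def[symmetric] S_def[symmetric]
      using frac[OF S le[OF H(1)]] frac[OF _ le[OF H(2)]] \<mu>_pos
        frac[of "4 * \<Lambda> * (alpha_max d M + 2 * Lmax + 2 * Mmax)"]
      by (subst Min_ge_iff) auto
  qed
qed

lemma complexity_const_exists:
  assumes "0 < C1"
  shows "\<exists>C. complexity_const L M \<mu> \<Lambda> C1 C"
proof -
  obtain H where H: "0 < H" "\<And>d \<eta>. 1 \<le> d \<Longrightarrow> 0 < \<eta> \<Longrightarrow> \<eta> \<le> 1 \<Longrightarrow>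
    \<eta> / (H * sqrt (real d)) \<le> h_tol d L M \<mu> \<Lambda> \<eta>"
    by (rule h_tol_lower_bound) blast
  \<comment> \<open>The summand 1 pays for the extra iteration, as \<open>d / \<eta>\<^sup>2\<close>
    is at least 1. The later factor 2 comes from \<open>d + 1 \<le> 2 * d\<close>.\<close>
  define B where "B = C1 * H\<^sup>2 / \<mu> + 1"
  have B: "0 < B" unfolding B_def using assms \<mu>_pos by (intro add_nonneg_pos) auto
  have "complexity_const L M \<mu> \<Lambda> C1 (2 * B)"
    unfolding complexity_const_def
  proof (intro allI impI)
    fix d :: nat and \<eta> :: real
    assume d: "1 \<le> d" and \<eta>: "0 < \<eta>" "\<eta> \<le> 1"
    let ?h = "h_tol d L M \<mu> \<Lambda> \<eta>"
    have d': "1 \<le> real d" using d by simp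
    have "(\<eta> / (H * sqrt (real d)))\<^sup>2 \<le> ?h\<^sup>2"
      using H d \<eta> by (intro power_mono) auto
    then have "\<eta>\<^sup>2 / (H\<^sup>2 * real d) \<le> ?h\<^sup>2" by (simp add: power_divide power_mult_distrib)
    then have "\<mu> * (\<eta>\<^sup>2 / (H\<^sup>2 * real d)) \<le> \<mu> * ?h\<^sup>2" using \<mu>_pos by (intro mult_left_mono) auto
    moreover have "0 < \<mu> * (\<eta>\<^sup>2 / (H\<^sup>2 * real d))" using \<mu>_pos \<eta> H(1) d' by simp
    moreover have "0 < \<mu> * ?h\<^sup>2" using \<mu>_pos h_tol_pos[OF \<eta>(1), of d] by simp
    ultimately have "iter_bound d L M \<mu> \<Lambda> C1 \<eta> \<le> C1 / (\<mu> * (\<eta>\<^sup>2 / (H\<^sup>2 * real d)))"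
      unfolding iter_bound_def using less_imp_le[OF assms] mult_pos_pos by (intro divide_left_mono)
    also have "\<dots> = C1 * H\<^sup>2 / \<mu> * (real d / \<eta>\<^sup>2)" by simp
    finally have "iter_bound d L M \<mu> \<Lambda> C1 \<eta> \<le> C1 * H\<^sup>2 / \<mu> * (real d / \<eta>\<^sup>2)" .
    moreover have "1 \<le> real d / \<eta>\<^sup>2"
    proof -
      have "\<eta>\<^sup>2 \<le> 1" using \<eta> by (simp add: power_le_one)
      then show ?thesis using d' \<eta> by (simp add: field_simps)
    qed
    ultimately have it: "iter_bound d L M \<mu> \<Lambda> C1 \<eta> + 1 \<le> B * (real d / \<eta>\<^sup>2)"
      unfolding B_def by (simp add: algebra_simps)
    have "0 \<le> B * (real d / \<eta>\<^sup>2)" using B by simp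
    then have "(real d + 1) * (B * (real d / \<eta>\<^sup>2)) \<le> (2 * real d) * (B * (real d / \<eta>\<^sup>2))"
      using d' by (intro mult_right_mono) auto
    moreover have "(real d + 1) * (iter_bound d L M \<mu> \<Lambda> C1 \<eta> + 1) \<le> (real d + 1) * (B * (real d / \<eta>\<^sup>2))"
      using it by (intro mult_left_mono) auto
    ultimately have "(real d + 1) * (iter_bound d L M \<mu> \<Lambda> C1 \<eta> + 1) \<le> (2 * real d) * (B * (real d / \<eta>\<^sup>2))"
      by linarith
    moreover have "2 * B * real d / \<eta>\<^sup>2 = 2 * (B * (real d / \<eta>\<^sup>2))"
      "2 * B * (real d)\<^sup>2 / \<eta>\<^sup>2 = (2 * real d) * (B * (real d / \<eta>\<^sup>2))"
      by (simp_all add: power2_eq_square)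
    ultimately show "iter_bound d L M \<mu> \<Lambda> C1 \<eta> + 1 \<le> 2 * B * real d / \<eta>\<^sup>2 \<and>
        (real d + 1) * (iter_bound d L M \<mu> \<Lambda> C1 \<eta> + 1) \<le> 2 * B * (real d)\<^sup>2 / \<eta>\<^sup>2"
      using it \<open>0 \<le> B * (real d / \<eta>\<^sup>2)\<close> by linarith
  qed
  then show ?thesis ..
qed

lemma num_samples_le: "real (num_samples f0 f L M \<mu> \<Lambda> x0 \<eta> kt) \<le> (real CARD('n) + 1) * real kt"
proof -
  have "card (sample_points f0 f L M \<mu> \<Lambda> x0 \<eta> k) \<le> CARD('n) + 1" for k
    unfolding sample_points_def Let_def
    by (rule order_trans[OF card_insert_le_m1]) (auto intro: card_image_le)
  then have "num_samples f0 f L M \<mu> \<Lambda> x0 \<eta> kt \<le> (\<Sum>k<kt. CARD('n) + 1)"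
    unfolding num_samples_def by (rule sum_mono)
  then have "real (num_samples f0 f L M \<mu> \<Lambda> x0 \<eta> kt) \<le> real (\<Sum>k<kt. CARD('n) + 1)"
    by (rule of_nat_mono)
  then show ?thesis by (simp add: algebra_simps)
qed

end

text \<open>The least-norm multiplier may be ambiguous, but acceptance at an index is not, so a
  bound for one run holds for all.\<close>

lemma szo_returns_unique:
  assumes "szo_returns f0 f L M \<mu> \<Lambda> x0 \<eta> \<xi> xt lt kt" "szo_returns f0 f L M \<mu> \<Lambda> x0 \<eta> \<xi> xt' lt' kt'"
  shows "kt = kt'"
  using assms unfolding szo_returns_def by (metis linorder_neqE_nat)

theorem theorem4:
  fixes f0 :: "real ^ 'n::finite \<Rightarrow> real"
    and f :: "'m::finite \<Rightarrow> real ^ 'n \<Rightarrow> real"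
    and L0 M0 :: real
    and L M :: "'m \<Rightarrow> real"
    and Omega_bar :: "(real ^ 'n) set"
    and x0 xc :: "real ^ 'n"
    and \<mu> \<Lambda> \<beta> :: real
  assumes f0_linear: "linear f0"
    and f0_C1: "cont_diff f0"
    and f_C1: "\<And>i. cont_diff (f i)"
    and Omega_bar: "feasible_set f \<subseteq> Omega_bar"
    and f0_smooth: "smoothness_constants (feasible_set f) Omega_bar f0 L0 M0"
    and f_smooth: "\<And>i. smoothness_constants (feasible_set f) Omega_bar (f i) (L i) (M i)"
    and x0_strictly_feasible: "\<And>i. f i x0 < 0"
    and sublevel_bounded: "bounded {x \<in> feasible_set f. f0 x \<le> \<beta>}"
    and x0_sublevel: "x0 \<in> {x \<in> feasible_set f. f0 x \<le> \<beta>}"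
    and mu_pos: "\<mu> > 0"
    and Lambda_pos: "\<Lambda> > 0"
    and xc_accumulation: "accumulation_point (szo_iterate f0 f L M \<mu> \<Lambda> x0) xc"
    and xc_licq: "licq f xc"
    and xc_multiplier: "infnorm (THE l. kkt_pair 0 f0 f xc l) < \<Lambda>"
    and xc_strict_min: "strict_local_minimizer f0 (feasible_set f) xc"
  defines "h \<equiv> h_tol CARD('n) L M \<mu> \<Lambda>"
    and "gap \<equiv> f0 x0 - (INF x\<in>feasible_set f. f0 x)"
  shows "\<exists>\<eta>bar. 0 < \<eta>bar \<and> \<eta>bar < 1 \<and>
    (\<forall>\<eta>. 0 < \<eta> \<and> \<eta> < \<eta>bar \<longrightarrow>
       (\<exists>xt lt kt. szo_returns f0 f L M \<mu> \<Lambda> x0 \<eta> (h \<eta>) xt lt kt \<and>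
          real kt \<le> iter_bound CARD('n) L M \<mu> \<Lambda> gap \<eta> + 1)) \<and>
    (\<forall>C1>0. (\<exists>C. complexity_const L M \<mu> \<Lambda> C1 C) \<and>
       (gap < C1 \<longrightarrow> (\<forall>C. complexity_const L M \<mu> \<Lambda> C1 C \<longrightarrow>
          (\<forall>\<eta>. 0 < \<eta> \<and> \<eta> \<le> \<eta>bar \<longrightarrow>
             (\<exists>xt lt kt. szo_returns f0 f L M \<mu> \<Lambda> x0 \<eta> (h \<eta>) xt lt kt) \<and>
             (\<forall>xt lt kt. szo_returns f0 f L M \<mu> \<Lambda> x0 \<eta> (h \<eta>) xt lt kt \<longrightarrow>
                real kt \<le> C * real CARD('n) / \<eta>\<^sup>2 \<and>
                real (num_samples f0 f L M \<mu> \<Lambda> x0 \<eta> kt) \<le> C * (real CARD('n))\<^sup>2 / \<eta>\<^sup>2 \<and>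
                kkt_pair \<eta> f0 f xt lt)))))"
proof -
  have C: "0 < L i" "0 < M i" "(L i)-lipschitz_on (feasible_set f) (f i)"
    "(M i)-lipschitz_on (feasible_set f) (grad (f i))" for i
    using f_smooth[of i] lipschitz_on_subset[OF _ Omega_bar] unfolding smoothness_constants_def by auto
  interpret smooth_constraints f L M
    by unfold_locales (use f_C1 C in auto)
  define g where "g = grad f0 0"
  interpret szo_algorithm f L M f0 g \<mu> \<Lambda> x0
    by unfold_locales
      (use grad_linear[OF f0_linear f0_C1, of _ 0] mu_pos Lambda_pos x0_strictly_feasible in
        \<open>auto simp: g_def strict_def inner_commute\<close>)
  have bdd: "bdd_below (f0 ` feasible_set f)"
  proof -
    have "bounded (f0 ` {x \<in> feasible_set f. f0 x \<le> \<beta>})"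
      using sublevel_bounded f0_linear by (intro bounded_linear_image) (auto simp: linear_conv_bounded_linear)
    then have "bdd_below (f0 ` {x \<in> feasible_set f. f0 x \<le> \<beta>})" by (rule bounded_imp_bdd_below)
    then obtain b where b: "\<And>x. x \<in> feasible_set f \<Longrightarrow> f0 x \<le> \<beta> \<Longrightarrow> b \<le> f0 x"
      by (auto simp: bdd_below_def)
    \<comment> \<open>Boundedness is known only on the sublevel set; above it \<open>\<beta>\<close>
      itself is a lower bound.\<close>
    have "min b \<beta> \<le> f0 x" if "x \<in> feasible_set f" for x using b[OF that] by (cases "f0 x \<le> \<beta>") auto
    then show ?thesis by (intro bdd_belowI2)
  qed
  obtain \<eta>1 where \<eta>1: "0 < \<eta>1"
    "\<And>\<eta>. 0 < \<eta> \<Longrightarrow> \<eta> < \<eta>1 \<Longrightarrow> \<exists>xt lt kt. szo_returns f0 f L M \<mu> \<Lambda> x0 \<eta> (h \<eta>) xt lt kt \<and>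
      real kt \<le> iter_bound CARD('n) L M \<mu> \<Lambda> gap \<eta> + 1"
    "\<And>\<eta> xt lt kt. 0 < \<eta> \<Longrightarrow> \<eta> < \<eta>1 \<Longrightarrow>
      szo_returns f0 f L M \<mu> \<Lambda> x0 \<eta> (h \<eta>) xt lt kt \<Longrightarrow> kkt_pair \<eta> f0 f xt lt"
    unfolding h_def gap_def
    by (rule termination_and_correctness[OF f0_C1 xc_accumulation xc_strict_min xc_licq xc_multiplier bdd]) blast
  \<comment> \<open>Halving admits \<open>\<eta> = \<eta>bar\<close> in the complexity claim while
    staying strictly below \<open>\<eta>1\<close> and 1.\<close>
  define \<eta>bar where "\<eta>bar = min \<eta>1 1 / 2"
  have bar: "0 < \<eta>bar" "\<eta>bar < 1" "\<eta>bar < \<eta>1" unfolding \<eta>bar_def using \<eta>1(1) by auto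
  have complexity: "real kt \<le> C * real CARD('n) / \<eta>\<^sup>2 \<and>
      real (num_samples f0 f L M \<mu> \<Lambda> x0 \<eta> kt) \<le> C * (real CARD('n))\<^sup>2 / \<eta>\<^sup>2"
    if C1: "gap < C1" "complexity_const L M \<mu> \<Lambda> C1 C" and \<eta>: "0 < \<eta>" "\<eta> \<le> \<eta>bar"
      and ret: "szo_returns f0 f L M \<mu> \<Lambda> x0 \<eta> (h \<eta>) xt lt kt" for C1 C \<eta> xt lt kt
  proof -
    have "real kt \<le> iter_bound CARD('n) L M \<mu> \<Lambda> gap \<eta> + 1"
      using \<eta>1(2)[of \<eta>] \<eta> bar szo_returns_unique[OF ret] by fastforce
    also have "iter_bound CARD('n) L M \<mu> \<Lambda> gap \<eta> \<le> iter_bound CARD('n) L M \<mu> \<Lambda> C1 \<eta>"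
      unfolding iter_bound_def using C1(1) mu_pos by (intro divide_right_mono) auto
    finally have kt: "real kt \<le> iter_bound CARD('n) L M \<mu> \<Lambda> C1 \<eta> + 1" by simp
    have cc: "iter_bound CARD('n) L M \<mu> \<Lambda> C1 \<eta> + 1 \<le> C * real CARD('n) / \<eta>\<^sup>2"
      "(real CARD('n) + 1) * (iter_bound CARD('n) L M \<mu> \<Lambda> C1 \<eta> + 1) \<le> C * (real CARD('n))\<^sup>2 / \<eta>\<^sup>2"
      using C1(2) \<eta> bar unfolding complexity_const_def by (auto simp: Suc_leI)
    have "(real CARD('n) + 1) * real kt \<le> (real CARD('n) + 1) * (iter_bound CARD('n) L M \<mu> \<Lambda> C1 \<eta> + 1)"
      using kt by (intro mult_left_mono) auto
    with kt cc num_samples_le[of \<eta> kt] show ?thesis by linarith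
  qed
  show ?thesis
  proof (rule exI[of _ \<eta>bar], intro conjI allI impI bar(1,2))
    fix \<eta> assume "0 < \<eta> \<and> \<eta> < \<eta>bar"
    with \<eta>1(2)[of \<eta>] bar show "\<exists>xt lt kt. szo_returns f0 f L M \<mu> \<Lambda> x0 \<eta> (h \<eta>) xt lt kt \<and>
        real kt \<le> iter_bound CARD('n) L M \<mu> \<Lambda> gap \<eta> + 1" by simp
  next
    fix C1 :: real assume "0 < C1"
    then show "\<exists>C. complexity_const L M \<mu> \<Lambda> C1 C" by (rule complexity_const_exists)
  next
    fix C1 C \<eta> :: real assume "0 < \<eta> \<and> \<eta> \<le> \<eta>bar"
    with \<eta>1(2)[of \<eta>] bar show "\<exists>xt lt kt. szo_returns f0 f L M \<mu> \<Lambda> x0 \<eta> (h \<eta>) xt lt kt" by fastforce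
  next
    fix C1 C \<eta> :: real and xt lt kt
    assume "gap < C1" "complexity_const L M \<mu> \<Lambda> C1 C" "0 < \<eta> \<and> \<eta> \<le> \<eta>bar"
      "szo_returns f0 f L M \<mu> \<Lambda> x0 \<eta> (h \<eta>) xt lt kt"
    then show "real kt \<le> C * real CARD('n) / \<eta>\<^sup>2"
      and "real (num_samples f0 f L M \<mu> \<Lambda> x0 \<eta> kt) \<le> C * (real CARD('n))\<^sup>2 / \<eta>\<^sup>2"
      and "kkt_pair \<eta> f0 f xt lt"
      using complexity[of C1 C \<eta> xt lt kt] \<eta>1(3)[of \<eta> xt lt kt] bar by auto
  qed
qed

end
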